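(* Let $f=h+\overline{g}\in\mathcal{H}$, where $h(z)=z+\sum_{n=2}^{\infty}a_nz^n$ and $g(z)=\sum_{n=1}^{\infty}b_nz^n$ are analytic in $\mathbb{D}$, and let $\alpha\in\mathbb{C}$. Assume that $$g'(z)=\alpha z h'(z)\quad (z\in\mathbb{D})\qquad\text{and}\qquad \sum_{n=2}^{\infty}n^2|a_n|\le 1.$$ If $|\alpha|\le 1$, then $f$ is univalent and close-to-convex in $\mathbb{D}$. If $|\alpha|\le 1/3$, then $f$ is fully starlike of order $\dfrac{2(1-3|\alpha|)}{5+3|\alpha|}$.
   Context: $\mathbb{D}=\{z\in\mathbb{C}:|z|<1\}$. $\mathcal{H}$ is the class of complex-valued harmonic functions $f$ in $\mathbb{D}$ with $f(0)=0$ and $f_z(0)=1$. A univalent harmonic function is close-to-convex if its image $f(\mathbb{D})$ is a close-to-convex domain, i.e. the complement of $f(\mathbb{D})$ in $\mathbb{C}$ can be written as a union of closed half-lines (rays) whose relative interiors are pairwise disjoint. For $0\le\beta<1$, $f\in\mathcal{H}$ is fully starlike of order $\beta$ if $f$ is univalent and sense-preserving in $\mathbb{D}$, maps $\mathbb{D}$ onto a domain starlike with respect to the origin, and satisfies $\frac{\partial}{\partial\theta}\arg f(re^{i\theta})>\beta$ for all $0\le\theta<2\pi$ and $0<r<1$. *)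

theory Defs
  imports "HOL-Complex_Analysis.Complex_Analysis"
begin

abbreviation unit_disc :: "complex set" where
  "unit_disc \<equiv> ball 0 1"

definition dx :: "(complex \<Rightarrow> complex) \<Rightarrow> complex \<Rightarrow> complex" where
  "dx f z = frechet_derivative f (at z) 1"

definition dy :: "(complex \<Rightarrow> complex) \<Rightarrow> complex \<Rightarrow> complex" where
  "dy f z = frechet_derivative f (at z) \<i>"

text \<open>The Wirtinger derivatives with respect to \<open>z\<close> and to the conjugate of \<open>z\<close>.\<close>

definition wirtinger :: "(complex \<Rightarrow> complex) \<Rightarrow> complex \<Rightarrow> complex" where
  "wirtinger f z = (dx f z - \<i> * dy f z) / 2"

definition wirtinger_bar :: "(complex \<Rightarrow> complex) \<Rightarrow> complex \<Rightarrow> complex" where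
  "wirtinger_bar f z = (dx f z + \<i> * dy f z) / 2"

text \<open>Only used for open \<open>S\<close>; differentiability is over the reals.\<close>

definition twice_cont_differentiable_on :: "(complex \<Rightarrow> complex) \<Rightarrow> complex set \<Rightarrow> bool" where
  "twice_cont_differentiable_on f S \<longleftrightarrow>
     f differentiable_on S \<and> dx f differentiable_on S \<and> dy f differentiable_on S \<and>
     continuous_on S (dx (dx f)) \<and> continuous_on S (dy (dx f)) \<and>
     continuous_on S (dx (dy f)) \<and> continuous_on S (dy (dy f))"

definition harmonic_on :: "(complex \<Rightarrow> complex) \<Rightarrow> complex set \<Rightarrow> bool" where
  "harmonic_on f S \<longleftrightarrow>
     twice_cont_differentiable_on f S \<and> (\<forall>z\<in>S. dx (dx f) z + dy (dy f) z = 0)"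

definition class_H :: "(complex \<Rightarrow> complex) set" where
  "class_H = {f. harmonic_on f unit_disc \<and> f 0 = 0 \<and> wirtinger f 0 = 1}"

definition univalent_on :: "(complex \<Rightarrow> complex) \<Rightarrow> complex set \<Rightarrow> bool" where
  "univalent_on f S \<longleftrightarrow> inj_on f S"

text \<open>The difference is the Jacobian determinant of \<open>f\<close> as a map of the real plane.\<close>

definition sense_preserving_on :: "(complex \<Rightarrow> complex) \<Rightarrow> complex set \<Rightarrow> bool" where
  "sense_preserving_on f S \<longleftrightarrow>
     (\<forall>z\<in>S. (cmod (wirtinger f z))\<^sup>2 - (cmod (wirtinger_bar f z))\<^sup>2 > 0)"

definition closed_ray :: "complex set \<Rightarrow> bool" where
  "closed_ray R \<longleftrightarrow> (\<exists>p d. d \<noteq> 0 \<and> R = {p + of_real t * d | t. t \<ge> 0})"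

text \<open>The family of rays may be empty, so the whole plane counts as close-to-convex.\<close>

definition close_to_convex_domain :: "complex set \<Rightarrow> bool" where
  "close_to_convex_domain S \<longleftrightarrow>
     open S \<and> connected S \<and> S \<noteq> {} \<and>
     (\<exists>\<R>. (\<forall>R\<in>\<R>. closed_ray R) \<and> - S = \<Union>\<R> \<and>
        (\<forall>R\<in>\<R>. \<forall>R'\<in>\<R>. R \<noteq> R' \<longrightarrow> rel_interior R \<inter> rel_interior R' = {}))"

definition close_to_convex :: "(complex \<Rightarrow> complex) \<Rightarrow> bool" where
  "close_to_convex f \<longleftrightarrow>
     harmonic_on f unit_disc \<and> univalent_on f unit_disc \<and> close_to_convex_domain (f ` unit_disc)"

definition starlike_domain :: "complex set \<Rightarrow> bool" where
  "starlike_domain S \<longleftrightarrow> open S \<and> 0 \<in> S \<and> (\<forall>w\<in>S. closed_segment 0 w \<subseteq> S)"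

text \<open>A continuous branch of the argument along a curve in the punctured plane. Any two
  branches differ by a constant, so the derivative of the argument does not depend on the
  choice.\<close>

definition arg_branch :: "(real \<Rightarrow> complex) \<Rightarrow> (real \<Rightarrow> real) \<Rightarrow> bool" where
  "arg_branch \<gamma> \<phi> \<longleftrightarrow>
     continuous_on UNIV \<phi> \<and>
     (\<forall>t. \<gamma> t \<noteq> 0 \<and> \<gamma> t = of_real (cmod (\<gamma> t)) * cis (\<phi> t))"

definition fully_starlike :: "real \<Rightarrow> (complex \<Rightarrow> complex) \<Rightarrow> bool" where
  "fully_starlike \<beta> f \<longleftrightarrow>
     0 \<le> \<beta> \<and> \<beta> < 1 \<and> f \<in> class_H \<and>
     univalent_on f unit_disc \<and> sense_preserving_on f unit_disc \<and>
     starlike_domain (f ` unit_disc) \<and>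
     (\<forall>r. 0 < r \<and> r < 1 \<longrightarrow>
        (\<exists>\<phi>. arg_branch (\<lambda>\<theta>. f (of_real r * cis \<theta>)) \<phi> \<and>
             (\<forall>\<theta>. 0 \<le> \<theta> \<and> \<theta> < 2 * pi \<longrightarrow>
                (\<exists>D. (\<phi> has_real_derivative D) (at \<theta>) \<and> D > \<beta>))))"

end

theory Submission
  imports Defs
begin

text \<open>
  The hypothesis \<open>\<Sum> n\<^sup>2 |a\<^sub>n| \<le> 1\<close> makes \<open>h\<close> a convex map. This is proved
  directly from the coefficients (\<open>inner_deriv_pos\<close>): every tangent to the image of a circle
  \<open>|z| = r\<close> is a support line, so the image of each closed disc is an intersection of half planes.

  In the coordinate \<open>w = h z\<close> on the convex domain \<open>\<Omega> = h(D)\<close>, the map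
  \<open>f\<close> becomes \<open>w + cnj (G w)\<close> with \<open>G = g \<circ> inv h\<close>. As
  \<open>|G'| = |g' / h'| = |\<alpha> z| < 1\<close>, the map \<open>G\<close> strictly decreases distances, and injectivity is
  immediate. For the complement of the image, let \<open>\<pi>\<close> be the closest point projection onto the
  closure of \<open>\<Omega>\<close>. The map \<open>w + cnj (G (\<pi> w))\<close> is an extension to the whole plane that
  carries the outside of \<open>\<Omega>\<close> onto the complement of \<open>f(D)\<close>, and it translates each outward
  normal ray of \<open>\<Omega>\<close>. The outside of \<open>\<Omega>\<close> is the union of these normal rays, so their
  translates are the rays that close-to-convexity asks for
  (\<open>close_to_convex_domain_nonexpansive_perturbation\<close>).

  For \<open>|\<alpha>| \<le> 1/3\<close>, the relation \<open>g' = \<alpha> z h'\<close> expresses the coefficients of \<open>g\<close>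
  through those of \<open>h\<close>, and gives the coefficient condition
  \<open>\<Sum> ((n - \<beta>) |a\<^sub>n| + (n + \<beta>) |b\<^sub>n|) \<le> 1 - \<beta>\<close>, the first sum being over
  \<open>n \<ge> 2\<close>. It implies that the argument of \<open>f\<close> increases along circles with speed greater than
  \<open>\<beta>\<close> (\<open>angular_derivative_gt\<close>). An injective orientation preserving map with increasing argument
  pulls radial segments back to curves that move away from the origin, so its image is starlike
  (\<open>starlike_image_of_increasing_arg\<close>).
\<close>

section \<open>Nonexpansive perturbations of the identity on a convex domain\<close>

lemma closest_point_along_normal:
  fixes S :: "'a::euclidean_space set"
  assumes S: "convex S" "closed S" and p: "p \<in> S" and t: "t \<ge> 0"
    and n: "\<And>x. x \<in> S \<Longrightarrow> inner n (x - p) \<le> 0"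
  shows "closest_point S (p + t *\<^sub>R n) = p"
proof (rule sym, rule closest_point_unique[OF S p], rule ballI)
  fix z assume "z \<in> S"
  then have "t * inner n (z - p) \<le> 0"
    using n t by (simp add: mult_nonneg_nonpos)
  moreover have "(norm (t *\<^sub>R n - (z - p)))\<^sup>2
      = (norm (t *\<^sub>R n))\<^sup>2 - 2 * (t * inner n (z - p)) + (norm (z - p))\<^sup>2"
    unfolding power2_norm_eq_inner by (simp add: inner_diff inner_commute algebra_simps)
  ultimately have "(norm (t *\<^sub>R n))\<^sup>2 \<le> (norm (t *\<^sub>R n - (z - p)))\<^sup>2"
    using zero_le_power2[of "norm (z - p)"] by linarith
  then have "norm (t *\<^sub>R n) \<le> norm (t *\<^sub>R n - (z - p))"
    by (rule power2_le_imp_le) simp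
  then show "dist (p + t *\<^sub>R n) p \<le> dist (p + t *\<^sub>R n) z"
    by (simp add: dist_norm algebra_simps)
qed

text \<open>The projection is firmly nonexpansive: with \<open>p\<close>, \<open>q\<close> the
  projections of \<open>x\<close>, \<open>y\<close>, the obtuse angle criterion at \<open>p\<close> and at \<open>q\<close> gives
  \<open>|p - q|\<^sup>2 + |(x - p) - (y - q)|\<^sup>2 \<le> |x - y|\<^sup>2\<close>. If no distance is lost, the second
  square must vanish.\<close>

lemma closest_point_isometric_imp_parallel:
  fixes S :: "'a::euclidean_space set"
  assumes S: "convex S" "closed S" "S \<noteq> {}"
    and eq: "dist (closest_point S x) (closest_point S y) = dist x y"
  shows "x - closest_point S x = y - closest_point S y"
proof -
  define p q where "p = closest_point S x" and "q = closest_point S y"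
  have "inner (x - p) (q - p) \<le> 0" "inner (y - q) (p - q) \<le> 0"
    unfolding p_def q_def using S by (auto intro!: closest_point_dot closest_point_in_set)
  then have ge: "0 \<le> inner (p - q) ((x - p) - (y - q))"
    by (simp add: inner_diff inner_commute algebra_simps)
  have "x - y = (p - q) + ((x - p) - (y - q))" by simp
  then have "(norm (x - y))\<^sup>2 = (norm ((p - q) + ((x - p) - (y - q))))\<^sup>2" by simp
  also have "\<dots> = (norm (p - q))\<^sup>2 + 2 * inner (p - q) ((x - p) - (y - q))
      + (norm ((x - p) - (y - q)))\<^sup>2"
    unfolding power2_norm_eq_inner by (simp only: inner_add inner_commute)
  finally have "(norm ((x - p) - (y - q)))\<^sup>2
      = - 2 * inner (p - q) ((x - p) - (y - q))"
    using eq[folded p_def q_def] by (simp add: dist_norm)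
  then have "(norm ((x - p) - (y - q)))\<^sup>2 \<le> 0" using ge by simp
  then have "norm ((x - p) - (y - q)) = 0" by simp
  then show ?thesis unfolding p_def q_def by (simp only: norm_eq_zero right_minus_eq)
qed

definition ray :: "complex \<Rightarrow> complex \<Rightarrow> complex set" where
  "ray q d = {q + of_real t * d | t. t \<ge> 0}"

text \<open>The end point of a ray is not a relative interior point, since the
  line through the ray continues beyond it.\<close>

lemma rel_interior_ray_subset:
  assumes d: "d \<noteq> 0" and w: "w \<in> rel_interior (ray q d)"
  obtains t where "t > 0" "w = q + of_real t * d"
proof -
  from w have "w \<in> ray q d" using rel_interior_subset by blast
  then obtain t where t: "t \<ge> 0" "w = q + of_real t * d" by (auto simp: ray_def)
  have "t \<noteq> 0"
  proof
    assume "t = 0"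
    with t w obtain e where e: "e > 0" "ball q e \<inter> affine hull (ray q d) \<subseteq> ray q d"
      by (auto simp: mem_rel_interior_ball)
    define s where "s = e / (2 * cmod d)"
    have s: "s > 0" using e d by (simp add: s_def)
    have q: "q \<in> ray q d" unfolding ray_def by (rule CollectI, rule exI[of _ 0]) simp
    moreover have "q + d \<in> ray q d" unfolding ray_def by (rule CollectI, rule exI[of _ 1]) simp
    ultimately have "(1 + s) *\<^sub>R q + (- s) *\<^sub>R (q + d) \<in> affine hull (ray q d)"
      by (intro mem_affine[OF affine_affine_hull] hull_inc) auto
    moreover have "(1 + s) *\<^sub>R q + (- s) *\<^sub>R (q + d) = q - of_real s * d"
      by (simp add: scaleR_conv_of_real algebra_simps)
    moreover have "q - of_real s * d \<in> ball q e"
      using s e d by (simp add: dist_norm norm_mult s_def norm_divide)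
    ultimately have "q - of_real s * d \<in> ray q d" using e by auto
    then obtain u where "u \<ge> 0" "q - of_real s * d = q + of_real u * d"
      by (auto simp: ray_def)
    then have "of_real (u + s) * d = 0" by (simp add: algebra_simps)
    then show False using d s \<open>u \<ge> 0\<close> by (simp only: mult_eq_0_iff of_real_eq_0_iff) auto
  qed
  with t have "t > 0" by simp
  then show ?thesis using t(2) by (rule that)
qed

text \<open>The rays that fill the complement are the images of the outward normal rays of \<open>\<Omega>\<close>. Let
  \<open>\<pi>\<close> be the closest point projection onto the closure of \<open>\<Omega>\<close>, and extend \<open>w + G w\<close> to
  the whole plane by \<open>w + G (\<pi> w)\<close>. On a normal ray \<open>\<pi>\<close> is constant, so this extension
  translates each normal ray. It is onto by Brouwer's theorem, because it differs from the identity by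
  a bounded continuous map, and it does not mix \<open>\<Omega>\<close> with its complement. Hence the translated
  normal rays cover exactly the complement of the image.

  Two of these rays can share an interior point only if \<open>\<pi>\<close> loses no distance
  between the two preimages. Then the offsets from the projections agree, and the two rays are the same
  set.\<close>

proposition close_to_convex_domain_nonexpansive_perturbation:
  fixes G :: "complex \<Rightarrow> complex"
  assumes \<Omega>: "open \<Omega>" "convex \<Omega>" "bounded \<Omega>" "\<Omega> \<noteq> {}"
    and G: "\<And>x y. \<lbrakk>x \<in> \<Omega>; y \<in> \<Omega>; x \<noteq> y\<rbrakk> \<Longrightarrow> dist (G x) (G y) < dist x y"
  shows "inj_on (\<lambda>w. w + G w) \<Omega>" and "close_to_convex_domain ((\<lambda>w. w + G w) ` \<Omega>)"
proof -
  define F where "F w = w + G w" for w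
  have disteq: "dist x y = dist (u::complex) v" if "x + u = y + v" for x y u v
  proof -
    from that have "u - v = y - x" by (simp add: algebra_simps)
    then show ?thesis by (metis dist_norm norm_minus_commute)
  qed
  show inj: "inj_on (\<lambda>w. w + G w) \<Omega>"
  proof (rule inj_onI, rule ccontr)
    fix x y assume "x \<in> \<Omega>" "y \<in> \<Omega>" "x + G x = y + G y" "x \<noteq> y"
    then show False using G disteq by fastforce
  qed
  have lip: "1-lipschitz_on \<Omega> G"
    using G by (intro lipschitz_onI) (force intro: less_imp_le)+
  then obtain H where H: "1-lipschitz_on (closure \<Omega>) H" and HG: "\<And>x. x \<in> \<Omega> \<Longrightarrow> H x = G x"
    using lipschitz_extend_closure by blast
  define C where "C = closure \<Omega>"
  have C: "convex C" "closed C" "C \<noteq> {}" "bounded C" "compact C"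
    using \<Omega> by (auto simp: C_def convex_closure bounded_closure)
  have \<Omega>C: "\<Omega> \<subseteq> C" by (simp add: C_def closure_subset)
  define \<pi> where "\<pi> = closest_point C"
  have \<pi>C: "\<pi> w \<in> C" for w using C by (simp add: \<pi>_def closest_point_in_set)
  have \<pi>id: "\<pi> w = w" if "w \<in> C" for w using that by (simp add: \<pi>_def closest_point_self)
  have \<pi>lip: "dist (\<pi> x) (\<pi> y) \<le> dist x y" for x y
    unfolding \<pi>_def using C by (intro closest_point_lipschitz)
  have Hlip: "dist (H x) (H y) \<le> dist x y" if "x \<in> C" "y \<in> C" for x y
    using lipschitz_onD[OF H] that by (simp add: C_def)
  \<comment> \<open>Passing to the extension \<open>H\<close> could lose strictness; the midpoint, which still lies
    in the open set \<open>\<Omega>\<close>, recovers it whenever one of the two points lies in \<open>\<Omega>\<close>.\<close>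
  have Hstrict: "dist (G x) (H y) < dist x y" if x: "x \<in> \<Omega>" and y: "y \<in> C" and ne: "x \<noteq> y" for x y
  proof -
    define m where "m = midpoint x y"
    have "m \<in> open_segment x y" using ne by (simp add: m_def)
    moreover have "open_segment x y \<subseteq> interior \<Omega>"
      by (rule in_interior_closure_convex_segment)
        (use \<Omega> x y in \<open>auto simp: C_def interior_open\<close>)
    ultimately have m: "m \<in> \<Omega>" "m \<noteq> x" using interior_subset by (auto simp: open_segment_def)
    have "dist (G x) (H y) \<le> dist (G x) (G m) + dist (H m) (H y)"
      using m HG by (metis dist_triangle)
    also have "\<dots> < dist x m + dist m y"
      using G[OF x m(1)] m Hlip[of m y] y \<Omega>C by force
    also have "\<dots> = dist x y" unfolding m_def by (simp add: dist_midpoint)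
    finally show ?thesis .
  qed
  define Ft where "Ft w = w + H (\<pi> w)" for w
  have FtF: "Ft w = F w" if "w \<in> \<Omega>" for w
    using that \<Omega>C HG by (auto simp: Ft_def F_def \<pi>id subsetD)
  have sep: "Ft x \<noteq> Ft y" if "x \<in> \<Omega>" "y \<notin> \<Omega>" for x y
  proof
    assume "Ft x = Ft y"
    then have eq: "dist x y = dist (G x) (H (\<pi> y))"
      using that \<Omega>C by (intro disteq) (simp add: Ft_def \<pi>id HG subsetD)
    show False
    proof (cases "x = \<pi> y")
      case True
      then have "x = y" using eq HG[OF that(1)] by simp
      with that show False by simp
    next
      case False
      then have "dist x y < dist (\<pi> x) (\<pi> y)"
        using eq Hstrict[OF that(1) \<pi>C False] that \<Omega>C by (simp add: \<pi>id subsetD)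
      then show False using \<pi>lip[of x y] by simp
    qed
  qed
  \<comment> \<open>A solution of \<open>Ft w = y\<close> is a fixed point of \<open>w \<mapsto> y - H (\<pi> w)\<close>, which maps a
    ball of the size of a bound for \<open>H\<close> into itself.\<close>
  have surj: "\<exists>w. Ft w = y" for y
  proof -
    have "compact (H ` C)"
      using C H by (intro compact_continuous_image lipschitz_on_continuous_on[of 1])
        (auto simp: C_def)
    then obtain M where M: "M > 0" "\<And>w. w \<in> C \<Longrightarrow> norm (H w) \<le> M"
      using compact_imp_bounded bounded_pos by (metis imageI)
    have "continuous_on UNIV (\<lambda>w. y - H (\<pi> w))"
    proof -
      have "1-lipschitz_on UNIV (\<lambda>w. H (\<pi> w))"
        using order_trans[OF Hlip[OF \<pi>C \<pi>C] \<pi>lip] by (intro lipschitz_onI) simp_all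
      then show ?thesis by (intro continuous_intros lipschitz_on_continuous_on)
    qed
    then have "continuous_on (cball y M) (\<lambda>w. y - H (\<pi> w))"
      by (rule continuous_on_subset) simp
    moreover have "(\<lambda>w. y - H (\<pi> w)) \<in> cball y M \<rightarrow> cball y M"
      using M \<pi>C by (auto simp: dist_norm)
    ultimately obtain w where "y - H (\<pi> w) = w"
      using brouwer_ball[OF M(1)] by metis
    then show ?thesis by (auto simp: Ft_def intro!: exI[of _ w] simp: algebra_simps)
  qed
  \<comment> \<open>\<open>P p n\<close>: \<open>n\<close> is a unit outward normal of the convex set \<open>C\<close> at \<open>p\<close>.\<close>
  define P where "P p n \<longleftrightarrow> p \<in> C \<and> norm n = 1 \<and> (\<forall>x\<in>C. inner n (x - p) \<le> 0)" for p n :: complex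
  define \<R> where "\<R> = {ray (p + H p) n | p n. P p n}"
  have \<pi>ray: "\<pi> (p + of_real t * n) = p" if "P p n" "t \<ge> 0" for p n t
    using closest_point_along_normal[of C p t n] C that
    by (auto simp: P_def \<pi>_def scaleR_conv_of_real)
  have outside: "p + of_real t * n \<notin> \<Omega>" if "P p n" "t \<ge> 0" for p n t
  proof
    assume in\<Omega>: "p + of_real t * n \<in> \<Omega>"
    then have p: "p \<in> \<Omega>" using \<pi>ray[OF that] \<pi>id \<Omega>C by fastforce
    then obtain e where e: "e > 0" "cball p e \<subseteq> \<Omega>" using \<Omega>(1) open_contains_cball by blast
    have "p + e *\<^sub>R n \<in> \<Omega>" using e that by (auto simp: P_def dist_norm intro!: subsetD[OF e(2)])
    then have "inner n (p + e *\<^sub>R n - p) \<le> 0" using that \<Omega>C unfolding P_def by blast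
    then have "e * inner n n \<le> 0" by simp
    moreover have "inner n n = 1" using that by (simp add: P_def dot_square_norm)
    ultimately show False using e by simp
  qed
  have cover: "\<exists>p n t. P p n \<and> t \<ge> 0 \<and> w = p + of_real t * n" if w: "w \<notin> \<Omega>" for w
  proof (cases "w \<in> C")
    case True
    have "w \<notin> rel_interior C"
      using w \<Omega> rel_interior_nonempty_interior[of C] convex_interior_closure[of \<Omega>]
      by (auto simp: C_def interior_open)
    then obtain a where a: "a \<noteq> 0" "\<And>y. y \<in> C \<Longrightarrow> a \<bullet> w \<le> a \<bullet> y"
      using supporting_hyperplane_rel_boundary[OF C(1) True] by metis
    define n where "n = - (a /\<^sub>R norm a)"
    have "P w n" using a True
      by (auto simp: P_def n_def inner_diff divide_le_cancel mult_le_cancel_left)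
    then show ?thesis by (intro exI[of _ w] exI[of _ n] exI[of _ 0]) auto
  next
    case False
    define n where "n = (w - \<pi> w) /\<^sub>R norm (w - \<pi> w)"
    have ne: "w - \<pi> w \<noteq> 0" using False \<pi>C[of w] by auto
    have "inner (w - \<pi> w) (x - \<pi> w) \<le> 0" if "x \<in> C" for x
      unfolding \<pi>_def using C that by (intro closest_point_dot)
    then have "P (\<pi> w) n" using ne \<pi>C by (auto simp: P_def n_def mult_nonneg_nonpos)
    moreover have "w = \<pi> w + of_real (norm (w - \<pi> w)) * n"
      using ne by (simp add: n_def scaleR_conv_of_real flip: mult.assoc of_real_inverse of_real_mult)
    ultimately show ?thesis by (metis norm_ge_zero)
  qed
  have Ftray: "Ft (p + of_real t * n) = (p + H p) + of_real t * n" if "P p n" "t \<ge> 0" for p n t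
    using \<pi>ray[OF that] by (simp add: Ft_def)
  have "- F ` \<Omega> = \<Union>\<R>"
  proof (intro set_eqI iffI)
    fix y assume y: "y \<in> - F ` \<Omega>"
    obtain w where w: "Ft w = y" using surj by blast
    then have "w \<notin> \<Omega>" using y FtF by auto
    then obtain p n t where pnt: "P p n" "t \<ge> 0" "w = p + of_real t * n" using cover by blast
    then have "y = (p + H p) + of_real t * n" using Ftray w by simp
    then have "y \<in> ray (p + H p) n" using pnt unfolding ray_def by blast
    moreover have "ray (p + H p) n \<in> \<R>" using pnt unfolding \<R>_def by blast
    ultimately show "y \<in> \<Union>\<R>" by blast
  next
    fix y assume "y \<in> \<Union>\<R>"
    then obtain p n where "P p n" "y \<in> ray (p + H p) n" unfolding \<R>_def by blast
    then obtain t where pnt: "P p n" "t \<ge> 0" "y = (p + H p) + of_real t * n"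
      unfolding ray_def by blast
    then have y: "y = Ft (p + of_real t * n)" using Ftray by simp
    show "y \<in> - F ` \<Omega>"
    proof
      assume "y \<in> F ` \<Omega>"
      then obtain x where "x \<in> \<Omega>" "Ft x = Ft (p + of_real t * n)"
        using y FtF by auto
      then show False using sep[OF _ outside[OF pnt(1,2)]] by blast
    qed
  qed
  moreover have "closed_ray R" if "R \<in> \<R>" for R
  proof -
    from that obtain p n where "P p n" "R = ray (p + H p) n" by (auto simp: \<R>_def)
    moreover from this have "n \<noteq> 0" by (auto simp: P_def)
    ultimately show ?thesis unfolding closed_ray_def ray_def by blast
  qed
  moreover have "R = R'" if R: "R \<in> \<R>" "R' \<in> \<R>" and y: "y \<in> rel_interior R" "y \<in> rel_interior R'" for R R' y
  proof -
    from R obtain p n q m where pn: "P p n" "R = ray (p + H p) n"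
      and qm: "P q m" "R' = ray (q + H q) m" by (auto simp: \<R>_def)
    have "n \<noteq> 0" "m \<noteq> 0" using pn qm by (auto simp: P_def)
    then obtain t s where t: "t > 0" "y = (p + H p) + of_real t * n"
      and s: "s > 0" "y = (q + H q) + of_real s * m"
      using y pn qm rel_interior_ray_subset by metis
    define u v where "u = p + of_real t * n" and "v = q + of_real s * m"
    have \<pi>u: "\<pi> u = p" and \<pi>v: "\<pi> v = q" unfolding u_def v_def using \<pi>ray pn qm t s by auto
    have "dist u v = dist (H p) (H q)"
      using t s by (intro disteq) (simp add: u_def v_def algebra_simps)
    then have "dist u v \<le> dist p q" using Hlip[of p q] pn qm by (simp add: P_def)
    then have "dist (\<pi> u) (\<pi> v) = dist u v" using \<pi>lip[of u v] \<pi>u \<pi>v by simp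
    then have "u - \<pi> u = v - \<pi> v" unfolding \<pi>_def using C
      by (intro closest_point_isometric_imp_parallel)
    then have tn: "of_real t * n = of_real s * m" by (simp add: \<pi>u \<pi>v) (simp add: u_def v_def)
    then have "norm (of_real t * n) = norm (of_real s * m)" by simp
    then have "t = s" using pn qm t s by (simp add: P_def norm_mult)
    with tn t have "n = m" by simp
    moreover have "p + H p = q + H q" using t s tn by simp
    ultimately show ?thesis using pn qm by simp
  qed
  moreover have "open (F ` \<Omega>)"
  proof (rule invariance_of_domain)
    show "continuous_on \<Omega> F" unfolding F_def
      using lipschitz_on_continuous_on[OF lip] by (intro continuous_intros)
    show "inj_on F \<Omega>" using inj unfolding F_def .
  qed (use \<Omega> in auto)
  moreover have "connected (F ` \<Omega>)"
    unfolding F_def using \<Omega> lipschitz_on_continuous_on[OF lip]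
    by (intro connected_continuous_image continuous_intros convex_connected)
  ultimately have "close_to_convex_domain (F ` \<Omega>)"
    unfolding close_to_convex_domain_def using \<Omega>(4) by (intro conjI exI[of _ \<R>]) blast+
  then show "close_to_convex_domain ((\<lambda>w. w + G w) ` \<Omega>)" unfolding F_def .
qed

section \<open>Convex maps from coefficient bounds\<close>

lemma inner_mult_left_complex: "inner (a * x) (a * y) = (cmod a)\<^sup>2 * inner x y" for a x y :: complex
  unfolding cmod_power2 inner_complex_def by (simp add: power2_eq_square algebra_simps)

lemma sums_norm_le:
  fixes f :: "nat \<Rightarrow> 'a::banach"
  assumes "f sums s" "\<And>n. norm (f n) \<le> g n" "summable g"
  shows "norm s \<le> (\<Sum>n. g n)"
  using norm_suminf_le[OF assms(2,3)] assms(1) by (simp add: sums_iff)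

lemma sums_mult_deriv:
  fixes f :: "complex \<Rightarrow> complex"
  assumes sums: "\<And>z. norm z < 1 \<Longrightarrow> (\<lambda>n. c n * z ^ n) sums f z"
    and deriv: "(f has_field_derivative f') (at z)" and z: "norm z < 1"
  shows "(\<lambda>n. of_nat n * c n * z ^ n) sums (z * f')"
proof -
  have "(\<lambda>n. diffs c n * z ^ n) sums f'"
    using termdiffs_sums_strong[OF sums deriv z] .
  then have "(\<lambda>n. z * (diffs c n * z ^ n)) sums (z * f')" by (rule sums_mult)
  then have "(\<lambda>n. of_nat (n + 1) * c (n + 1) * z ^ (n + 1)) sums (z * f')"
    by (simp add: diffs_def mult_ac)
  then show ?thesis by (subst (asm) sums_zero_iff_shift) auto
qed

text \<open>The plain Lipschitz bound for the \<open>n\<close>-th power on the unit disc, with an additional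
  factor \<open>|w|\<close>. That factor is what later makes inequalities strict inside the disc.\<close>

lemma norm_power_diff_le:
  fixes z w :: complex
  assumes "cmod z \<le> cmod w" "cmod w \<le> 1" "n \<ge> 2"
  shows "cmod (w ^ n - z ^ n) \<le> real n * (cmod w * cmod (w - z))"
proof -
  obtain m where n: "n = Suc (Suc m)" using assms(3) by (metis add_2_eq_Suc le_Suc_ex)
  have "w ^ n - z ^ n = w * (w ^ Suc m - z ^ Suc m) + z ^ Suc m * (w - z)"
    unfolding n by (simp add: algebra_simps)
  then have "cmod (w ^ n - z ^ n)
      \<le> cmod w * cmod (w ^ Suc m - z ^ Suc m) + cmod (z ^ Suc m) * cmod (w - z)"
    by (metis norm_mult norm_triangle_ineq)
  also have "\<dots> \<le> cmod w * (real (Suc m) * cmod (w - z)) + cmod w * cmod (w - z)"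
  proof (intro add_mono mult_left_mono mult_right_mono norm_power_diff)
    have "cmod z ^ Suc m \<le> cmod z ^ 1"
      using assms by (intro power_decreasing) auto
    then have "cmod z ^ Suc m \<le> cmod z" by (simp only: power_one_right)
    then show "cmod (z ^ Suc m) \<le> cmod w" using assms unfolding norm_power by linarith
  qed (use assms in auto)
  finally show ?thesis by (simp add: n algebra_simps)
qed

text \<open>A second order estimate of the \<open>n\<close>-th power at \<open>w\<close>, multiplied by \<open>w\<close>: up
  to the factor \<open>w\<close>, the left side is \<open>z\<^sup>n\<close> minus its tangent at \<open>w\<close>.\<close>

lemma norm_power_taylor_le:
  fixes z w :: complex
  assumes "cmod z \<le> cmod w" "cmod w \<le> 1"
  shows "cmod (of_nat n * w ^ n * (w - z) - w * (w ^ n - z ^ n))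
    \<le> real n * (real n - 1) / 2 * (cmod w * (cmod (w - z))\<^sup>2)"
proof (induction n)
  case (Suc n)
  define \<Delta> where "\<Delta> = of_nat n * w ^ n * (w - z) - w * (w ^ n - z ^ n)"
  have eq: "of_nat (Suc n) * w ^ Suc n * (w - z) - w * (w ^ Suc n - z ^ Suc n)
      = w * (\<Delta> + (w - z) * (w ^ n - z ^ n))"
    unfolding \<Delta>_def by (simp add: algebra_simps)
  have "cmod \<Delta> \<le> real n * (real n - 1) / 2 * (1 * (cmod (w - z))\<^sup>2)"
  proof -
    have nn: "0 \<le> real n * (real n - 1) / 2" by (cases n) auto
    have "cmod w * (cmod (w - z))\<^sup>2 \<le> 1 * (cmod (w - z))\<^sup>2"
      using assms by (intro mult_right_mono) auto
    then show ?thesis using Suc.IH mult_left_mono[OF _ nn] unfolding \<Delta>_def by force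
  qed
  moreover have "cmod ((w - z) * (w ^ n - z ^ n)) \<le> cmod (w - z) * (real n * cmod (w - z))"
    unfolding norm_mult using assms by (intro mult_left_mono norm_power_diff) auto
  ultimately have "cmod (\<Delta> + (w - z) * (w ^ n - z ^ n))
      \<le> real (Suc n) * (real (Suc n) - 1) / 2 * (cmod (w - z))\<^sup>2"
    using norm_triangle_ineq[of \<Delta> "(w - z) * (w ^ n - z ^ n)"]
    by (simp add: power2_eq_square field_simps)
  then have "cmod w * cmod (\<Delta> + (w - z) * (w ^ n - z ^ n))
      \<le> cmod w * (real (Suc n) * (real (Suc n) - 1) / 2 * (cmod (w - z))\<^sup>2)"
    by (intro mult_left_mono) auto
  then show ?case unfolding eq norm_mult by (simp add: mult_ac)
qed simp

text \<open>A sequence \<open>c\<close> that starts at index 0, with its first two entries equal to 0, avoids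
  index shifts in all sums below.\<close>

locale convex_coefficients =
  fixes h :: "complex \<Rightarrow> complex" and c :: "nat \<Rightarrow> complex"
  assumes holo: "h holomorphic_on ball 0 1"
    and series: "\<And>z. cmod z < 1 \<Longrightarrow> (\<lambda>n. c n * z ^ n) sums (h z - z)"
    and c_0: "c 0 = 0" and c_1: "c 1 = 0"
    and summable_c: "summable (\<lambda>n. (real n)\<^sup>2 * cmod (c n))"
    and suminf_c: "(\<Sum>n. (real n)\<^sup>2 * cmod (c n)) \<le> 1"
begin

lemma c_eq_0: "n < 2 \<Longrightarrow> c n = 0"
  using c_0 c_1 by (auto simp: less_2_cases_iff)

lemma summable_weighted:
  assumes "\<And>n. n \<ge> 2 \<Longrightarrow> \<bar>v n\<bar> \<le> (real n)\<^sup>2"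
  shows "summable (\<lambda>n. v n * cmod (c n))"
proof (rule summable_comparison_test'[OF summable_c])
  show "norm (v n * cmod (c n)) \<le> (real n)\<^sup>2 * cmod (c n)" if "n \<ge> 0" for n
    using assms[of n] c_eq_0[of n] by (cases "n < 2") (auto simp: abs_mult intro!: mult_right_mono)
qed

lemma DERIV_h: "cmod z < 1 \<Longrightarrow> (h has_field_derivative deriv h z) (at z)"
  using holo by (auto intro: holomorphic_derivI)

lemma series_deriv:
  assumes "cmod z < 1"
  shows "(\<lambda>n. of_nat n * c n * z ^ n) sums (z * deriv h z - z)"
proof -
  have "((\<lambda>z. h z - z) has_field_derivative deriv h z - 1) (at z)"
    using DERIV_h[OF assms] by (auto intro!: derivative_eq_intros)
  from sums_mult_deriv[OF series this assms] show ?thesis by (simp add: algebra_simps)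
qed

text \<open>The vector \<open>\<zeta> h'(\<zeta>)\<close> is an outward normal to the image of the circle through
  \<open>\<zeta>\<close>, so this says that the image of the closed disc within lies on the inner side of the
  tangent at \<open>h \<zeta>\<close>: every boundary tangent is a support line. For the identity map it holds
  because \<open>\<zeta> / (\<zeta> - z)\<close> has real part at least \<open>1/2\<close>. With \<open>V = h \<zeta> - h z\<close> and
  \<open>U = \<zeta> h'(\<zeta>)\<close> one has \<open>(\<zeta> - z) U = \<zeta> V + W\<close>, and with
  \<open>d = |\<zeta> - z|\<close> the two lengths satisfy \<open>|W| \<le> d\<^sup>2 / 2 * \<Sum> n (n - 1) |c\<^sub>n|\<close>
  and \<open>|V| \<ge> d (1 - \<Sum> n |c\<^sub>n|)\<close>. The term \<open>W\<close> does not spoil positivity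
  if \<open>|W| / d \<le> |V| / 2\<close>, which holds because the two sums add up to
  \<open>\<Sum> n\<^sup>2 |c\<^sub>n| \<le> 1\<close>. Both bounds gain a factor \<open>|\<zeta>| < 1\<close> in front of
  their sums, and this makes the inequality strict.\<close>

proposition inner_deriv_pos:
  assumes z: "cmod z \<le> cmod \<zeta>" "cmod \<zeta> < 1" "z \<noteq> \<zeta>"
  shows "inner (h \<zeta> - h z) (\<zeta> * deriv h \<zeta>) > 0"
proof -
  define V U where "V = h \<zeta> - h z" and "U = \<zeta> * deriv h \<zeta>"
  define W where "W = (\<zeta> - z) * U - \<zeta> * V"
  define d \<rho> where "d = cmod (\<zeta> - z)" and "\<rho> = cmod \<zeta>"
  define \<sigma> T where "\<sigma> = (\<Sum>n. real n * cmod (c n))"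
    and "T = (\<Sum>n. real n * (real n - 1) * cmod (c n))"
  have d: "d > 0" using z by (simp add: d_def)
  have \<rho>: "\<rho> \<ge> 0" "\<rho> < 1" using z by (auto simp: \<rho>_def)
  have z1: "cmod z < 1" using z by simp
  have sum\<sigma>: "summable (\<lambda>n. real n * cmod (c n))"
    by (rule summable_weighted) (auto simp: power2_eq_square)
  have sumT: "summable (\<lambda>n. real n * (real n - 1) * cmod (c n))"
    by (rule summable_weighted) (auto simp: power2_eq_square abs_mult algebra_simps)
  have "\<sigma> + T = (\<Sum>n. (real n)\<^sup>2 * cmod (c n))"
    unfolding \<sigma>_def T_def suminf_add[OF sum\<sigma> sumT]
    by (simp add: algebra_simps power2_eq_square)
  then have \<sigma>T: "\<sigma> + T \<le> 1" using suminf_c by simp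
  have D: "(\<lambda>n. c n * (\<zeta> ^ n - z ^ n)) sums (V - (\<zeta> - z))"
    using sums_diff[OF series[OF z(2)] series[OF z1]]
    by (simp add: V_def algebra_simps)
  have "cmod (V - (\<zeta> - z)) \<le> (\<Sum>n. \<rho> * d * (real n * cmod (c n)))"
  proof (rule sums_norm_le[OF D])
    show "cmod (c n * (\<zeta> ^ n - z ^ n)) \<le> \<rho> * d * (real n * cmod (c n))" for n
    proof (cases "n < 2")
      case False
      then have "cmod (\<zeta> ^ n - z ^ n) \<le> real n * (\<rho> * d)"
        unfolding \<rho>_def d_def using z by (intro norm_power_diff_le) auto
      then have "cmod (c n) * cmod (\<zeta> ^ n - z ^ n) \<le> cmod (c n) * (real n * (\<rho> * d))"
        by (intro mult_left_mono) auto
      then show ?thesis by (simp add: norm_mult mult_ac)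
    qed (simp add: c_eq_0)
  qed (intro summable_mult sum\<sigma>)
  also have "\<dots> = \<rho> * d * \<sigma>" unfolding \<sigma>_def by (rule suminf_mult[OF sum\<sigma>])
  finally have "cmod (V - (\<zeta> - z)) \<le> \<rho> * d * \<sigma>" .
  moreover have "d \<le> cmod V + cmod (V - (\<zeta> - z))"
    unfolding d_def using norm_triangle_ineq4[of V "V - (\<zeta> - z)"] by simp
  ultimately have V: "cmod V \<ge> d - \<rho> * d * \<sigma>" by simp
  have "(\<lambda>n. c n * (of_nat n * \<zeta> ^ n * (\<zeta> - z) - \<zeta> * (\<zeta> ^ n - z ^ n))) sums W"
  proof -
    have "(\<lambda>n. (\<zeta> - z) * (of_nat n * c n * \<zeta> ^ n) - \<zeta> * (c n * (\<zeta> ^ n - z ^ n)))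
        sums ((\<zeta> - z) * (U - \<zeta>) - \<zeta> * (V - (\<zeta> - z)))"
      unfolding U_def by (intro sums_diff sums_mult series_deriv D z)
    then show ?thesis by (simp add: W_def algebra_simps)
  qed
  then have "cmod W \<le> (\<Sum>n. \<rho> * d\<^sup>2 / 2 * (real n * (real n - 1) * cmod (c n)))"
  proof (rule sums_norm_le)
    fix n
    have "cmod (c n) * cmod (of_nat n * \<zeta> ^ n * (\<zeta> - z) - \<zeta> * (\<zeta> ^ n - z ^ n))
        \<le> cmod (c n) * (real n * (real n - 1) / 2 * (\<rho> * d\<^sup>2))"
      unfolding \<rho>_def d_def using z by (intro mult_left_mono norm_power_taylor_le) auto
    then show "cmod (c n * (of_nat n * \<zeta> ^ n * (\<zeta> - z) - \<zeta> * (\<zeta> ^ n - z ^ n)))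
        \<le> \<rho> * d\<^sup>2 / 2 * (real n * (real n - 1) * cmod (c n))"
      by (simp add: norm_mult mult_ac)
  qed (intro summable_mult sumT)
  also have "\<dots> = \<rho> * d\<^sup>2 / 2 * T" unfolding T_def by (rule suminf_mult[OF sumT])
  finally have W: "cmod W \<le> \<rho> * d\<^sup>2 / 2 * T" .
  have "\<rho> * (\<sigma> + T) < 1" using mult_left_mono[OF \<sigma>T \<rho>(1)] \<rho> by simp
  then have "d * (\<rho> * (\<sigma> + T)) < d * 1" using d by (intro mult_strict_left_mono) auto
  then have gap: "cmod V - \<rho> * d * T > 0" using V by (simp add: algebra_simps)
  have "\<rho> * d * T \<ge> 0"
  proof -
    have "0 \<le> real n * (real n - 1) * cmod (c n)" for n by (cases n) auto
    then have "T \<ge> 0" unfolding T_def by (intro suminf_nonneg sumT)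
    then show ?thesis using \<rho> d by simp
  qed
  with gap have Vpos: "cmod V > 0" by linarith
  \<comment> \<open>This is the bound \<open>1/2\<close> for the real part of \<open>\<zeta> / (\<zeta> - z)\<close>.\<close>
  have half: "inner (\<zeta> - z) \<zeta> \<ge> d\<^sup>2 / 2"
  proof -
    have "(cmod z)\<^sup>2 \<le> (cmod \<zeta>)\<^sup>2" using z by (intro power_mono) auto
    then show ?thesis
      unfolding d_def power2_norm_eq_inner by (simp add: inner_diff inner_commute)
  qed
  have "d\<^sup>2 * inner V U = inner ((\<zeta> - z) * V) ((\<zeta> - z) * U)"
    by (simp add: inner_mult_left_complex d_def)
  also have "(\<zeta> - z) * U = \<zeta> * V + W" by (simp add: W_def)
  also have "inner ((\<zeta> - z) * V) (\<zeta> * V + W)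
      = (cmod V)\<^sup>2 * inner (\<zeta> - z) \<zeta> + inner ((\<zeta> - z) * V) W"
    by (simp add: inner_add mult.commute[of _ V] inner_mult_left_complex)
  also have "\<dots> \<ge> (cmod V)\<^sup>2 * (d\<^sup>2 / 2) - d * cmod V * (\<rho> * d\<^sup>2 / 2 * T)"
  proof -
    have "\<bar>inner ((\<zeta> - z) * V) W\<bar> \<le> cmod ((\<zeta> - z) * V) * cmod W"
      by (rule Cauchy_Schwarz_ineq2)
    also have "\<dots> \<le> d * cmod V * (\<rho> * d\<^sup>2 / 2 * T)"
      using W d by (simp add: norm_mult d_def mult_left_mono)
    finally show ?thesis using mult_left_mono[OF half, of "(cmod V)\<^sup>2"] by simp
  qed
  finally have "d\<^sup>2 * inner V U \<ge> cmod V * d\<^sup>2 / 2 * (cmod V - \<rho> * d * T)"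
    by (simp add: power2_eq_square algebra_simps)
  moreover have "cmod V * d\<^sup>2 / 2 * (cmod V - \<rho> * d * T) > 0"
    using Vpos gap d by simp
  ultimately have "d\<^sup>2 * inner V U > 0" by linarith
  then show ?thesis using d unfolding V_def U_def by (simp add: zero_less_mult_iff)
qed

lemma inj: "inj_on h (ball 0 1)"
proof (rule inj_onI, rule ccontr)
  fix x y assume *: "x \<in> ball 0 1" "y \<in> ball 0 1" "h x = h y" "x \<noteq> y"
  show False
    using inner_deriv_pos[of x y] inner_deriv_pos[of y x] * by (cases "cmod x \<le> cmod y") auto
qed

lemma h_0: "h 0 = 0"
proof -
  have "(\<lambda>n. c n * 0 ^ n) = (\<lambda>n. 0)"
    using c_0 by (auto simp: fun_eq_iff power_0_left)
  then show ?thesis using series[of 0] by (metis diff_zero norm_zero sums_0 sums_unique2 zero_less_one)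
qed

text \<open>The image is the intersection of the half planes cut off by its tangents. A point outside the image
  is separated from it as follows: the segment from 0 to that point leaves the image at some \<open>h \<zeta>\<close>
  with \<open>|\<zeta>| = r\<close>, and since 0 lies strictly on the inner side of the tangent there, the rest of
  the segment lies strictly on the outer side.\<close>

lemma convex_image_cball:
  assumes r: "0 < r" "r < 1"
  shows "convex (h ` cball 0 r)"
proof -
  define K where "K = h ` cball 0 r"
  define N where "N \<zeta> = \<zeta> * deriv h \<zeta>" for \<zeta>
  have cont: "continuous_on (cball 0 r) h"
    using r by (intro holomorphic_on_imp_continuous_on holomorphic_on_subset[OF holo]) auto
  have K: "compact K" unfolding K_def by (intro compact_continuous_image cont) auto
  have "K = (\<Inter>\<zeta>\<in>sphere 0 r. {w. inner (N \<zeta>) w \<le> inner (N \<zeta>) (h \<zeta>)})"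
  proof (intro set_eqI iffI)
    fix w assume "w \<in> K"
    then obtain z where z: "cmod z \<le> r" "w = h z" by (auto simp: K_def)
    have "inner (N \<zeta>) w \<le> inner (N \<zeta>) (h \<zeta>)" if "cmod \<zeta> = r" for \<zeta>
      using inner_deriv_pos[of z \<zeta>] z that r
      by (cases "z = \<zeta>") (auto simp: N_def inner_diff inner_commute)
    then show "w \<in> (\<Inter>\<zeta>\<in>sphere 0 r. {w. inner (N \<zeta>) w \<le> inner (N \<zeta>) (h \<zeta>)})" by auto
  next
    fix w assume w: "w \<in> (\<Inter>\<zeta>\<in>sphere 0 r. {w. inner (N \<zeta>) w \<le> inner (N \<zeta>) (h \<zeta>)})"
    show "w \<in> K"
    proof (rule ccontr)
      assume nw: "w \<notin> K"
      have 0: "0 \<in> K" using r h_0 unfolding K_def by (intro image_eqI[of _ _ 0]) auto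
      have "closed_segment 0 w \<inter> frontier K \<noteq> {}"
        using 0 nw by (intro connected_Int_frontier) auto
      then obtain x where x: "x \<in> closed_segment 0 w" "x \<in> frontier K" by blast
      then obtain s where s: "0 \<le> s" "s \<le> 1" "x = s *\<^sub>R w" by (auto simp: in_segment)
      have "x \<in> K" using x K by (simp add: frontier_def compact_imp_closed)
      then obtain \<zeta> where \<zeta>: "cmod \<zeta> \<le> r" "x = h \<zeta>" by (auto simp: K_def)
      have "cmod \<zeta> = r"
      proof (rule ccontr)
        assume "cmod \<zeta> \<noteq> r"
        then have "x \<in> h ` ball 0 r" using \<zeta> by auto
        moreover have "open (h ` ball 0 r)"
          using r inj holo
          by (intro open_mapping_thm3) (auto intro: holomorphic_on_subset inj_on_subset)
        moreover have "h ` ball 0 r \<subseteq> K" unfolding K_def by auto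
        ultimately have "x \<in> interior K" by (meson interiorI)
        with x show False by (simp add: frontier_def)
      qed
      have "inner (N \<zeta>) w \<le> inner (N \<zeta>) (h \<zeta>)"
        using w \<open>cmod \<zeta> = r\<close> by auto
      also have "\<dots> = s * inner (N \<zeta>) w" by (simp flip: \<zeta>(2) add: s(3))
      finally have "inner (N \<zeta>) w \<le> s * inner (N \<zeta>) w" .
      then have "(1 - s) * inner (N \<zeta>) w \<le> 0" by (simp add: algebra_simps)
      moreover have "s \<noteq> 1" using s \<open>x \<in> K\<close> nw by auto
      ultimately have "inner (N \<zeta>) w \<le> 0" using s by (simp add: mult_le_0_iff)
      moreover have "s * inner (N \<zeta>) w > 0"
        using inner_deriv_pos[of 0 \<zeta>] \<open>cmod \<zeta> = r\<close> r \<zeta>(2) s(3)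
        by (force simp: h_0 N_def inner_commute)
      ultimately show False using s by (simp add: zero_less_mult_iff)
    qed
  qed
  then show ?thesis unfolding K_def[symmetric] by (auto intro!: convex_INT convex_halfspace_le)
qed

lemma convex_image: "convex (h ` ball 0 1)"
  unfolding convex_contains_segment
proof (intro ballI)
  fix x y assume "x \<in> h ` ball 0 1" "y \<in> h ` ball 0 1"
  then obtain u v where uv: "cmod u < 1" "cmod v < 1" "x = h u" "y = h v" by auto
  define r where "r = max (1/2) (max (cmod u) (cmod v))"
  have r: "0 < r" "r < 1" using uv by (auto simp: r_def)
  have "x \<in> h ` cball 0 r" "y \<in> h ` cball 0 r" using uv by (auto simp: r_def)
  then have "closed_segment x y \<subseteq> h ` cball 0 r"
    using convex_image_cball[OF r] by (rule closed_segment_subset)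
  also have "\<dots> \<subseteq> h ` ball 0 1" using r by auto
  finally show "closed_segment x y \<subseteq> h ` ball 0 1" .
qed

lemma bounded_image: "bounded (h ` ball 0 1)"
proof -
  have "cmod (h z) \<le> 2" if "cmod z < 1" for z
  proof -
    have "cmod (h z - z) \<le> (\<Sum>n. (real n)\<^sup>2 * cmod (c n))"
    proof (rule sums_norm_le[OF series[OF that] _ summable_c])
      show "cmod (c n * z ^ n) \<le> (real n)\<^sup>2 * cmod (c n)" for n
      proof (cases "n < 2")
        case False
        then have "1 * 1 \<le> real n * real n" by (intro mult_mono) auto
        moreover have "cmod z ^ n \<le> 1" using that by (simp add: power_le_one)
        ultimately have "cmod z ^ n \<le> (real n)\<^sup>2" by (simp add: power2_eq_square)
        then show ?thesis by (simp add: norm_mult norm_power mult_left_mono mult.commute)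
      qed (simp add: c_eq_0)
    qed
    then show ?thesis using suminf_c norm_triangle_ineq[of "h z - z" z] that by simp
  qed
  then show ?thesis by (auto simp: bounded_iff intro!: exI[of _ 2])
qed

end


section \<open>Shears of convex maps\<close>

text \<open>In the coordinate \<open>w = h z\<close> the map becomes \<open>w + cnj (G w)\<close> with
  \<open>G = g \<circ> inv h\<close>, and \<open>|G'| = |g' / h'| < 1\<close>. On a convex domain the mean value
  inequality turns this into \<open>|G x - G y| < |x - y|\<close>.\<close>

theorem shear_of_convex_map:
  assumes S: "open S" "S \<noteq> {}" and h: "h holomorphic_on S" "inj_on h S"
    and g: "g holomorphic_on S"
    and img: "convex (h ` S)" "bounded (h ` S)"
    and dil: "\<And>z. z \<in> S \<Longrightarrow> cmod (deriv g z) < cmod (deriv h z)"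
  shows "inj_on (\<lambda>z. h z + cnj (g z)) S"
    and "close_to_convex_domain ((\<lambda>z. h z + cnj (g z)) ` S)"
proof -
  obtain k where k: "k holomorphic_on (h ` S)"
    "\<And>z. z \<in> S \<Longrightarrow> deriv h z * deriv k (h z) = 1" "\<And>z. z \<in> S \<Longrightarrow> k (h z) = z"
    using holomorphic_has_inverse[OF h(1) S(1) h(2)] by metis
  define \<Omega> where "\<Omega> = h ` S"
  have op: "open \<Omega>" unfolding \<Omega>_def using open_mapping_thm3 h S by blast
  define G where "G w = g (k w)" for w
  have kS: "k w \<in> S" if "w \<in> \<Omega>" for w using that k(3) by (auto simp: \<Omega>_def)
  have holG: "G holomorphic_on \<Omega>"
    using holomorphic_on_compose_gen[OF k(1) g] kS by (auto simp: G_def[abs_def] o_def \<Omega>_def)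
  have dG: "cmod (deriv G w) < 1" if "w \<in> \<Omega>" for w
  proof -
    from that obtain z where z: "z \<in> S" "w = h z" by (auto simp: \<Omega>_def)
    have "(k has_field_derivative deriv k w) (at w)"
      using k(1) op that by (intro holomorphic_derivI[of _ \<Omega>]) (auto simp: \<Omega>_def)
    moreover have "(g has_field_derivative deriv g z) (at (k w))"
      using g S z k(3) by (auto intro: holomorphic_derivI)
    ultimately have "(G has_field_derivative deriv g z * deriv k w) (at w)"
      unfolding G_def by (rule DERIV_chain2[rotated])
    then have "deriv G w = deriv g z * deriv k w" by (rule DERIV_imp_deriv)
    moreover have "deriv k w \<noteq> 0" using k(2)[OF z(1)] z by auto
    ultimately have "cmod (deriv G w) < cmod (deriv h z) * cmod (deriv k w)"
      using dil[OF z(1)] by (simp add: norm_mult)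
    also have "\<dots> = 1" using k(2)[OF z(1)] z by (metis norm_mult norm_one)
    finally show ?thesis .
  qed
  have contr: "dist (cnj (G x)) (cnj (G y)) < dist x y" if "x \<in> \<Omega>" "y \<in> \<Omega>" "x \<noteq> y" for x y
  proof -
    have sub: "closed_segment x y \<subseteq> \<Omega>" using img that by (auto simp: \<Omega>_def convex_contains_segment)
    \<comment> \<open>\<open>|G'|\<close> may approach 1 at the boundary of \<open>\<Omega>\<close>, but on a compact segment it has a
      maximum below 1.\<close>
    have "continuous_on (closed_segment x y) (\<lambda>w. cmod (deriv G w))"
      using holomorphic_deriv[OF holG op] sub
      by (intro continuous_on_norm) (blast intro: continuous_on_subset holomorphic_on_imp_continuous_on)
    then obtain m where m: "m \<in> closed_segment x y"
      "\<And>w. w \<in> closed_segment x y \<Longrightarrow> cmod (deriv G w) \<le> cmod (deriv G m)"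
      using continuous_attains_sup[of "closed_segment x y" "\<lambda>w. cmod (deriv G w)"] by auto
    have "norm (G x - G y) \<le> cmod (deriv G m) * norm (x - y)"
    proof (rule field_differentiable_bound)
      show "(G has_field_derivative deriv G z) (at z within closed_segment x y)"
        if "z \<in> closed_segment x y" for z
        using holomorphic_derivI[OF holG op] sub that by blast
    qed (use m in auto)
    also have "\<dots> < 1 * norm (x - y)"
      using dG[of m] m sub that by (intro mult_strict_right_mono) auto
    finally show ?thesis by (simp add: dist_norm flip: complex_cnj_diff)
  qed
  note pert = close_to_convex_domain_nonexpansive_perturbation[OF op, of "\<lambda>w. cnj (G w)"]
  have eq: "(\<lambda>z. h z + cnj (g z)) ` S = (\<lambda>w. w + cnj (G w)) ` \<Omega>"
    unfolding \<Omega>_def image_image by (rule image_cong) (auto simp: G_def k)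
  show "close_to_convex_domain ((\<lambda>z. h z + cnj (g z)) ` S)"
    unfolding eq using img S contr by (intro pert) (auto simp: \<Omega>_def)
  have "inj_on (\<lambda>w. w + cnj (G w)) \<Omega>"
    using img S contr by (intro pert) (auto simp: \<Omega>_def)
  then have "inj_on ((\<lambda>w. w + cnj (G w)) \<circ> h) S"
    unfolding \<Omega>_def by (rule comp_inj_on[OF h(2)])
  then show "inj_on (\<lambda>z. h z + cnj (g z)) S"
    by (rule iffD1[OF inj_on_cong, rotated]) (auto simp: G_def k)
qed

section \<open>Starlike images and the argument along circles\<close>

lemma has_derivative_plus_cnj:
  assumes "(h has_field_derivative a) (at z)" "(g has_field_derivative b) (at z)"
  shows "((\<lambda>z. h z + cnj (g z)) has_derivative (\<lambda>v. a * v + cnj (b * v))) (at z)"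
  using assms unfolding has_field_derivative_def
  by (intro has_derivative_add has_derivative_cnj) 

text \<open>The positivity hypothesis says that the argument of \<open>f\<close> increases along circles. Because
  \<open>f\<close> preserves orientation, it also says that moving the value \<open>f \<zeta>\<close> away from the origin
  moves \<open>\<zeta>\<close> outwards: if \<open>D\<close> is the inverse of the derivative of \<open>f\<close> at \<open>\<zeta>\<close>
  and \<open>J\<close> the Jacobian, then \<open>inner \<zeta> (D (f \<zeta>))\<close> is the hypothesised quantity divided
  by \<open>J\<close>. So a preimage cannot leave a closed disc around 0 while its value shrinks radially to 0,
  and the image of every closed disc around 0 is starlike.\<close>

theorem starlike_image_of_increasing_arg:
  fixes h g :: "complex \<Rightarrow> complex"
  defines "f \<equiv> \<lambda>z. h z + cnj (g z)"
  assumes h: "h holomorphic_on ball 0 1" and g: "g holomorphic_on ball 0 1"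
    and inj: "inj_on f (ball 0 1)" and f0: "f 0 = 0"
    and dil: "\<And>z. z \<in> ball 0 1 \<Longrightarrow> cmod (deriv g z) < cmod (deriv h z)"
    and pos: "\<And>z. \<lbrakk>z \<in> ball 0 1; z \<noteq> 0\<rbrakk> \<Longrightarrow> inner (z * deriv h z - cnj (z * deriv g z)) (f z) > 0"
  shows "starlike_domain (f ` ball 0 1)"
proof -
  define \<Omega> where "\<Omega> = f ` ball 0 1"
  define F where "F = inv_into (ball 0 1) f"
  have Ff: "F (f z) = z" if "z \<in> ball 0 1" for z
    using inj that by (simp add: F_def)
  have cont: "continuous_on (ball 0 1) f"
    unfolding f_def using h g by (intro continuous_intros holomorphic_on_imp_continuous_on)
  have op: "open \<Omega>" unfolding \<Omega>_def by (intro invariance_of_domain cont inj) auto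
  have radial: "\<exists>D>0. ((\<lambda>t. (cmod (F (t *\<^sub>R w)))\<^sup>2) has_real_derivative D) (at s)"
    if \<zeta>: "\<zeta> \<in> ball 0 1" "\<zeta> \<noteq> 0" "s *\<^sub>R w = f \<zeta>" and s: "s > 0" for \<zeta> w s
  proof -
    define a b where "a = deriv h \<zeta>" and "b = deriv g \<zeta>"
    define J where "J = (cmod a)\<^sup>2 - (cmod b)\<^sup>2"
    have J: "J > 0" using dil[OF \<zeta>(1)] by (simp add: J_def a_def b_def power_strict_mono)
    define B where "B v = (cnj a * v - cnj b * cnj v) / of_real J" for v
    have "(F has_derivative B) (at (f \<zeta>))"
    proof (rule has_derivative_inverse_strong[where f = f and S = "ball 0 1" and
          f' = "\<lambda>v. a * v + cnj (b * v)"])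
      show "(f has_derivative (\<lambda>v. a * v + cnj (b * v))) (at \<zeta>)"
        unfolding f_def a_def b_def using \<zeta> h g
        by (intro has_derivative_plus_cnj) (auto intro: holomorphic_derivI)
      show "(\<lambda>v. a * v + cnj (b * v)) \<circ> B = id"
      proof
        fix v
        have "a * (cnj a * v - cnj b * cnj v) + cnj (b * (cnj a * v - cnj b * cnj v))
            = (a * cnj a - b * cnj b) * v"
          by (simp add: algebra_simps)
        also have "\<dots> = of_real J * v"
          by (simp add: J_def flip: complex_norm_square)
        finally show "((\<lambda>v. a * v + cnj (b * v)) \<circ> B) v = id v"
          using J by (simp add: B_def field_simps)
      qed
    qed (use \<zeta> cont Ff in auto)
    then have dF: "(F has_derivative B) (at (s *\<^sub>R w))" using \<zeta> by simp
    have "((\<lambda>t. t *\<^sub>R w) has_derivative (\<lambda>t. t *\<^sub>R w)) (at s)"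
      by (auto intro!: derivative_eq_intros)
    from has_derivative_compose[OF this dF]
    have "((\<lambda>t. F (t *\<^sub>R w)) has_derivative (\<lambda>t. B (t *\<^sub>R w))) (at s)" .
    from has_derivative_inner[OF this this]
    have "((\<lambda>t. (cmod (F (t *\<^sub>R w)))\<^sup>2) has_derivative (\<lambda>t. t * (2 * inner \<zeta> (B w)))) (at s)"
      using \<zeta> Ff by (simp add: power2_norm_eq_inner B_def inner_commute scaleR_conv_of_real
          inner_complex_def algebra_simps diff_divide_distrib)
    then have "((\<lambda>t. (cmod (F (t *\<^sub>R w)))\<^sup>2) has_real_derivative 2 * inner \<zeta> (B w)) (at s)"
      unfolding has_field_derivative_def mult_commute_abs .
    moreover have "inner \<zeta> (B w) > 0"
    proof -
      have "inner \<zeta> (B (f \<zeta>)) = inner (\<zeta> * a - cnj (\<zeta> * b)) (f \<zeta>) / J"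
        by (simp add: B_def inner_complex_def algebra_simps add_divide_distrib diff_divide_distrib)
      moreover have "B (f \<zeta>) = s *\<^sub>R B w"
        unfolding \<zeta>(3)[symmetric] B_def by (simp add: scaleR_conv_of_real algebra_simps)
      ultimately have "s * inner \<zeta> (B w) > 0"
        using pos[OF \<zeta>(1,2)] J by (simp add: a_def b_def)
      then show ?thesis using s by (simp add: zero_less_mult_iff)
    qed
    ultimately show ?thesis by (intro exI[of _ "2 * inner \<zeta> (B w)"]) simp
  qed
  have "t *\<^sub>R f z \<in> \<Omega>" if z: "z \<in> ball 0 1" and t: "0 \<le> t" "t \<le> 1" for z t
  proof -
    define w where "w = f z"
    define r where "r = cmod z"
    define K where "K = f ` cball 0 r"
    have r: "r < 1" using z by (simp add: r_def)
    have K\<Omega>: "K \<subseteq> \<Omega>" unfolding K_def \<Omega>_def using r by (intro image_mono) auto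
    have 0: "0 \<in> K" unfolding K_def using f0 by (intro image_eqI[of _ _ 0]) (auto simp: r_def)
    have wK: "w \<in> K" by (auto simp: K_def w_def r_def)
    have "compact K" unfolding K_def using r
      by (intro compact_continuous_image continuous_on_subset[OF cont]) auto
    then have clK: "closed K" by (rule compact_imp_closed)
    \<comment> \<open>Suppose that the segment from 0 to \<open>w\<close> leaves \<open>K\<close>. At the last exit parameter \<open>s\<close>,
      decreasing the parameter slightly would move the preimage inwards, hence stay in \<open>K\<close>.\<close>
    define T where "T = {t \<in> {0..1}. t *\<^sub>R w \<notin> K}"
    have "T = {}"
    proof (rule ccontr)
      assume ne: "T \<noteq> {}"
      have bdd: "bdd_above T" by (auto simp: T_def intro: bdd_aboveI[of _ 1])
      define s where "s = Sup T"
      have s1: "s \<le> 1" unfolding s_def using ne by (intro cSup_least) (auto simp: T_def)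
      have s_ge: "t \<le> s" if "t \<in> T" for t unfolding s_def using that bdd by (rule cSup_upper)
      have s0: "s \<ge> 0" using ne s_ge by (force simp: T_def)
      have contw: "continuous_on UNIV (\<lambda>t. t *\<^sub>R w)" by (intro continuous_intros)
      have sK: "s *\<^sub>R w \<in> K"
      proof (rule ccontr)
        assume n: "s *\<^sub>R w \<notin> K"
        have "open ((\<lambda>t. t *\<^sub>R w) -` (- K))"
          using clK contw by (intro open_vimage) auto
        then obtain e where e: "e > 0" "\<And>t. dist t s < e \<Longrightarrow> t *\<^sub>R w \<notin> K"
          using n unfolding open_dist by auto
        have "s \<noteq> 1" using n wK by auto
        define t where "t = min 1 (s + e / 2)"
        have t: "s < t" "t \<le> 1" "dist t s < e"
          using \<open>s \<noteq> 1\<close> s1 e(1) by (auto simp: t_def dist_real_def min_def)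
        then have "t \<in> T" using s0 e(2)[OF t(3)] by (auto simp: T_def)
        then show False using s_ge t by fastforce
      qed
      have "s \<noteq> 0"
      proof
        assume "s = 0"
        obtain t where "t \<in> T" using ne by blast
        then have "t = 0" using s_ge[of t] \<open>s = 0\<close> by (auto simp: T_def)
        then show False using \<open>t \<in> T\<close> 0 by (auto simp: T_def)
      qed
      then have s: "s > 0" using s0 by simp
      obtain \<zeta> where \<zeta>: "cmod \<zeta> \<le> r" "s *\<^sub>R w = f \<zeta>" using sK by (auto simp: K_def)
      have "w \<noteq> 0" using ne 0 by (auto simp: T_def)
      then have "\<zeta> \<noteq> 0" using \<zeta> s f0 by auto
      moreover have \<zeta>b: "\<zeta> \<in> ball 0 1" using \<zeta> r by simp
      ultimately obtain D where "D > 0"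
        "((\<lambda>t. (cmod (F (t *\<^sub>R w)))\<^sup>2) has_real_derivative D) (at s)"
        using radial \<zeta>(2) s by blast
      then obtain d where d: "d > 0"
        "\<And>\<eta>. 0 < \<eta> \<Longrightarrow> \<eta> < d \<Longrightarrow> (cmod (F ((s - \<eta>) *\<^sub>R w)))\<^sup>2 < (cmod (F (s *\<^sub>R w)))\<^sup>2"
        using DERIV_pos_inc_left by blast
      have "open ((\<lambda>t. t *\<^sub>R w) -` \<Omega>)"
        using op contw by (intro open_vimage) auto
      then obtain e where e: "e > 0" "\<And>t. dist t s < e \<Longrightarrow> t *\<^sub>R w \<in> \<Omega>"
        using sK K\<Omega> unfolding open_dist by blast
      obtain t where t: "t \<in> T" "s - min d e < t"
        using less_cSupD[OF ne, of "s - min d e"] d e s_def by auto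
      have "t \<noteq> s" using t sK by (auto simp: T_def)
      then have ts: "t < s" using s_ge t by force
      have "t *\<^sub>R w \<in> \<Omega>" using t ts by (intro e(2)) (auto simp: dist_real_def)
      then obtain x where x: "x \<in> ball 0 1" "t *\<^sub>R w = f x" by (auto simp: \<Omega>_def)
      have "(cmod (F (t *\<^sub>R w)))\<^sup>2 < (cmod (F (s *\<^sub>R w)))\<^sup>2"
        using d(2)[of "s - t"] t ts by simp
      then have "(cmod x)\<^sup>2 < (cmod \<zeta>)\<^sup>2"
        by (simp only: x(2) \<zeta>(2) Ff[OF x(1)] Ff[OF \<zeta>b])
      then have "cmod x < cmod \<zeta>" by (rule power_less_imp_less_base) simp
      then have "t *\<^sub>R w \<in> K" using x \<zeta> by (auto simp: K_def)
      then show False using t by (simp add: T_def)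
    qed
    then have "t *\<^sub>R w \<in> K" using t by (auto simp: T_def)
    then show ?thesis using K\<Omega> by (auto simp: w_def)
  qed
  then have "closed_segment 0 w \<subseteq> \<Omega>" if "w \<in> \<Omega>" for w
    using that by (auto simp: \<Omega>_def in_segment)
  moreover have "0 \<in> \<Omega>" unfolding \<Omega>_def using f0 by (intro image_eqI[of _ _ 0]) auto
  ultimately show ?thesis using op unfolding starlike_domain_def \<Omega>_def by blast
qed

text \<open>Since \<open>f z / z\<close> stays in the disc of radius 1 around 1, its principal argument is smooth,
  and adding the argument \<open>\<theta>\<close> of \<open>z\<close> itself gives an explicit branch along the whole
  circle.\<close>

lemma arg_branch_near_identity:
  fixes f :: "complex \<Rightarrow> complex"
  assumes r: "r > 0"
    and near: "\<And>z. cmod z = r \<Longrightarrow> cmod (f z - z) < cmod z"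
    and deriv: "\<And>z. cmod z = r \<Longrightarrow> (f has_derivative f' z) (at z)"
  obtains \<phi> where "arg_branch (\<lambda>\<theta>. f (of_real r * cis \<theta>)) \<phi>"
    and "\<And>\<theta> z. z = of_real r * cis \<theta> \<Longrightarrow> (\<phi> has_real_derivative Im (f' z (\<i> * z) / f z)) (at \<theta>)"
proof -
  define \<zeta> where "\<zeta> \<theta> = of_real r * cis \<theta>" for \<theta>
  have \<zeta>: "cmod (\<zeta> \<theta>) = r" "\<zeta> \<theta> \<noteq> 0" for \<theta> using r by (auto simp: \<zeta>_def norm_mult)
  define q where "q \<theta> = f (\<zeta> \<theta>) / \<zeta> \<theta>" for \<theta>
  have qRe: "Re (q \<theta>) > 0" for \<theta>
  proof -
    have "cmod (q \<theta> - 1) < 1"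
    proof -
      have "q \<theta> - 1 = (f (\<zeta> \<theta>) - \<zeta> \<theta>) / \<zeta> \<theta>" using \<zeta>(2) by (simp add: q_def field_simps)
      then show ?thesis using near[OF \<zeta>(1)] \<zeta>(2) by (simp add: norm_divide)
    qed
    then have "\<bar>Re (q \<theta> - 1)\<bar> < 1" using abs_Re_le_cmod le_less_trans by blast
    then show ?thesis by simp
  qed
  have q0: "q \<theta> \<noteq> 0" "q \<theta> \<notin> \<real>\<^sub>\<le>\<^sub>0" for \<theta>
    using qRe[of \<theta>] by (auto simp: complex_nonpos_Reals_iff)
  have fq: "f (\<zeta> \<theta>) = q \<theta> * \<zeta> \<theta>" for \<theta> using \<zeta>(2) by (simp add: q_def)
  define \<phi> where "\<phi> \<theta> = \<theta> + Im (Ln (q \<theta>))" for \<theta>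
  have d\<zeta>: "(\<zeta> has_vector_derivative \<i> * \<zeta> \<theta>) (at \<theta>)" for \<theta>
    unfolding \<zeta>_def[abs_def] has_vector_derivative_def
    by (auto intro!: derivative_eq_intros simp: scaleR_conv_of_real)
  have dcis: "((\<lambda>\<theta>. cis (- \<theta>)) has_vector_derivative - \<i> * cis (- \<theta>)) (at \<theta>)" for \<theta>
    unfolding has_vector_derivative_def
    by (auto intro!: derivative_eq_intros simp: scaleR_conv_of_real)
  have inv: "1 / \<zeta> \<theta> = cis (- \<theta>) / of_real r" for \<theta>
    using r by (simp add: \<zeta>_def cis_inverse[symmetric] field_simps)
  have q_eq: "q = (\<lambda>\<theta>. f (\<zeta> \<theta>) * cis (- \<theta>) / of_real r)"
    using inv by (metis (no_types) q_def mult.right_neutral times_divide_eq_right)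
  have d\<phi>: "(\<phi> has_real_derivative Im (f' (\<zeta> \<theta>) (\<i> * \<zeta> \<theta>) / f (\<zeta> \<theta>))) (at \<theta>)" for \<theta>
  proof -
    define A where "A = f' (\<zeta> \<theta>) (\<i> * \<zeta> \<theta>)"
    have bl: "bounded_linear (f' (\<zeta> \<theta>))" using deriv[OF \<zeta>(1)] by (rule has_derivative_bounded_linear)
    have "((\<lambda>\<theta>. f (\<zeta> \<theta>)) has_vector_derivative A) (at \<theta>)"
      using has_derivative_compose[OF d\<zeta>[of \<theta>, unfolded has_vector_derivative_def] deriv[OF \<zeta>(1)]]
      by (simp add: has_vector_derivative_def A_def linear_scale[OF bounded_linear.linear[OF bl]])
    from has_vector_derivative_mult[OF this dcis]
    have "((\<lambda>\<theta>. f (\<zeta> \<theta>) * cis (- \<theta>)) has_vector_derivative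
        f (\<zeta> \<theta>) * (- \<i> * cis (- \<theta>)) + A * cis (- \<theta>)) (at \<theta>)" .
    from has_vector_derivative_divide[OF this, of "of_real r"]
    have "(q has_vector_derivative (A - \<i> * f (\<zeta> \<theta>)) * (cis (- \<theta>) / of_real r)) (at \<theta>)"
      by (simp add: q_eq algebra_simps diff_divide_distrib)
    then have "(q has_vector_derivative (A - \<i> * f (\<zeta> \<theta>)) * (1 / \<zeta> \<theta>)) (at \<theta>)"
      by (simp only: inv)
    from field_vector_diff_chain_at[OF this has_field_derivative_Ln[OF q0(2)]]
    have "((\<lambda>\<theta>. Ln (q \<theta>)) has_vector_derivative A / f (\<zeta> \<theta>) - \<i>) (at \<theta>)"
      using \<zeta>(2) q0(1) by (simp add: o_def fq field_simps)
    from bounded_linear.has_vector_derivative[OF bounded_linear_Im this]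
    have "((\<lambda>\<theta>. Im (Ln (q \<theta>))) has_real_derivative Im (A / f (\<zeta> \<theta>)) - 1) (at \<theta>)"
      by (simp add: has_real_derivative_iff_has_vector_derivative)
    from DERIV_add[OF DERIV_ident this] show ?thesis
      by (simp add: \<phi>_def[abs_def] A_def)
  qed
  have "arg_branch (\<lambda>\<theta>. f (of_real r * cis \<theta>)) \<phi>"
    unfolding arg_branch_def
  proof (intro conjI allI)
    show "continuous_on UNIV \<phi>"
      using d\<phi> by (intro continuous_at_imp_continuous_on) (blast intro: DERIV_isCont)
    fix \<theta>
    have "q \<theta> = of_real (cmod (q \<theta>)) * cis (Im (Ln (q \<theta>)))"
      using q0(1)[of \<theta>] by (metis Arg_eq_Im_Ln cis_conv_exp Arg_eq)
    then have "q \<theta> * \<zeta> \<theta> = of_real (cmod (q \<theta>) * r) * (cis (Im (Ln (q \<theta>))) * cis \<theta>)"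
      by (simp add: \<zeta>_def)
    then show "f (of_real r * cis \<theta>) = of_real (cmod (f (of_real r * cis \<theta>))) * cis (\<phi> \<theta>)"
      unfolding \<zeta>_def[symmetric] fq using \<zeta>(1) r by (simp add: norm_mult cis_mult \<phi>_def add.commute)
    show "f (of_real r * cis \<theta>) \<noteq> 0"
      unfolding \<zeta>_def[symmetric] fq using q0 \<zeta>(2) by simp
  qed
  then show ?thesis using d\<phi> unfolding \<zeta>_def by (intro that) auto
qed

section \<open>The coefficient condition for starlikeness\<close>

lemma power_series_coeff_unique:
  fixes p q :: "nat \<Rightarrow> complex"
  assumes "\<And>z. cmod z < 1 \<Longrightarrow> (\<lambda>n. p n * z ^ n) sums F z"
    and "\<And>z. cmod z < 1 \<Longrightarrow> (\<lambda>n. q n * z ^ n) sums F z"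
    and "n > 0"
  shows "p n = q n"
proof (rule ccontr)
  assume "p n \<noteq> q n"
  have sums_0: "(\<lambda>n. (p n - q n) * (z - 0) ^ n) sums 0" if "norm (z - 0) < 1" for z
    using sums_diff[OF assms(1)[of z] assms(2)[of z]] that by (simp add: algebra_simps)
  show False
  proof (rule powser_0_nonzero[where a = "\<lambda>n. p n - q n" and f = "\<lambda>_. 0" and \<xi> = 0
        and r = 1 and m = n])
    fix s :: real
    assume "0 < s" and nz: "\<And>z::complex. z \<in> cball 0 s - {0} \<Longrightarrow> (0::complex) \<noteq> 0"
    then have "of_real s \<in> cball (0::complex) s - {0}" by auto
    from nz[OF this] show False by simp
  qed (use sums_0 \<open>p n \<noteq> q n\<close> assms(3) in simp_all)
qed

locale convex_shear = convex_coefficients +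
  fixes g :: "complex \<Rightarrow> complex" and e :: "nat \<Rightarrow> complex" and \<alpha> :: complex
  assumes holo_g: "g holomorphic_on ball 0 1"
    and series_g: "\<And>z. cmod z < 1 \<Longrightarrow> (\<lambda>n. e n * z ^ n) sums g z"
    and e_0: "e 0 = 0"
    and dilatation: "\<And>z. cmod z < 1 \<Longrightarrow> deriv g z = \<alpha> * z * deriv h z"
begin

abbreviation f where "f z \<equiv> h z + cnj (g z)"

lemma deriv_h_nonzero: "cmod z < 1 \<Longrightarrow> deriv h z \<noteq> 0"
  using holomorphic_injective_imp_regular[OF holo _ inj] by auto

lemma dilatation_less:
  assumes "cmod \<alpha> \<le> 1" "cmod z < 1"
  shows "cmod (deriv g z) < cmod (deriv h z)"
proof -
  have "cmod \<alpha> * cmod z < 1"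
    using assms by (metis mult_left_le_one_le norm_ge_zero order_le_less_trans)
  then show ?thesis
    using deriv_h_nonzero[OF assms(2)] by (simp add: dilatation[OF assms(2)] norm_mult)
qed

lemma g_0: "g 0 = 0"
proof -
  have "(\<lambda>n. e n * 0 ^ n) = (\<lambda>n. 0)"
    using e_0 by (auto simp: fun_eq_iff power_0_left)
  then show ?thesis using series_g[of 0] by (metis norm_zero sums_0 sums_unique2 zero_less_one)
qed

lemma univalent: "cmod \<alpha> \<le> 1 \<Longrightarrow> inj_on f (ball 0 1)"
  and close_to_convex_image: "cmod \<alpha> \<le> 1 \<Longrightarrow> close_to_convex_domain (f ` ball 0 1)"
  using shear_of_convex_map[OF _ _ holo inj holo_g convex_image bounded_image] dilatation_less
  by auto

lemma DERIV_g: "cmod z < 1 \<Longrightarrow> (g has_field_derivative deriv g z) (at z)"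
  using holo_g by (auto intro: holomorphic_derivI)

lemma series_deriv_g: "cmod z < 1 \<Longrightarrow> (\<lambda>n. of_nat n * e n * z ^ n) sums (z * deriv g z)"
  using sums_mult_deriv[OF series_g DERIV_g] .

text \<open>Comparing coefficients in \<open>z g'(z) = \<alpha> z (z h'(z))\<close>; the additional 1 at
  \<open>n = 1\<close> comes from the leading term \<open>z\<close> of \<open>h\<close>.\<close>

lemma coeff_g:
  "of_nat (Suc n) * e (Suc n) = \<alpha> * (of_nat n * c n + (if n = 1 then 1 else 0))"
proof -
  define q where "q m = (case m of 0 \<Rightarrow> 0
      | Suc n \<Rightarrow> \<alpha> * (of_nat n * c n + (if n = 1 then 1 else 0)))" for m
  have "(\<lambda>m. q m * z ^ m) sums (z * deriv g z)" if z: "cmod z < 1" for z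
  proof -
    have "(\<lambda>n. of_nat n * c n * z ^ n + (if n = 1 then z ^ n else 0))
        sums ((z * deriv h z - z) + z ^ 1)"
      by (intro sums_add series_deriv z sums_single)
    from sums_mult[OF this, of "\<alpha> * z"]
    have "(\<lambda>n. \<alpha> * z * (of_nat n * c n * z ^ n + (if n = 1 then z ^ n else 0)))
        sums (\<alpha> * z * (z * deriv h z))" by simp
    also have "(\<lambda>n. \<alpha> * z * (of_nat n * c n * z ^ n + (if n = 1 then z ^ n else 0)))
        = (\<lambda>n. q (Suc n) * z ^ Suc n)"
      by (auto simp: fun_eq_iff q_def algebra_simps)
    finally have "(\<lambda>n. q (Suc n) * z ^ Suc n) sums (\<alpha> * z * (z * deriv h z))" .
    then have "(\<lambda>n. q n * z ^ n) sums (\<alpha> * z * (z * deriv h z))"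
      by (intro sums_Suc_imp[of "\<lambda>n. q n * z ^ n"]) (simp_all add: q_def)
    then show ?thesis by (simp add: dilatation[OF z] mult_ac)
  qed
  from power_series_coeff_unique[OF series_deriv_g this, of "Suc n"]
  show ?thesis by (simp add: q_def)
qed

lemma e_1: "e 1 = 0"
  using coeff_g[of 0] by simp

lemma e_eq_0: "n < 2 \<Longrightarrow> e n = 0"
  using e_0 e_1 by (auto simp: less_2_cases_iff)

text \<open>The ratio \<open>(n - \<beta>) / n\<^sup>2\<close> with \<open>n \<ge> 2\<close> is largest at \<open>n = 2\<close>, so all
  of the mass of \<open>\<Sum> n\<^sup>2 |c\<^sub>n|\<close> may be thought of as sitting there.\<close>

lemma h_coeff_bound:
  assumes "0 \<le> \<beta>" "\<beta> \<le> 1"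
  shows "summable (\<lambda>n. (real n - \<beta>) * cmod (c n))"
    and "(\<Sum>n. (real n - \<beta>) * cmod (c n)) \<le> (2 - \<beta>) / 4"
proof -
  have le: "(real n - \<beta>) * cmod (c n) \<le> (2 - \<beta>) / 4 * ((real n)\<^sup>2 * cmod (c n))" for n
  proof (cases "n < 2")
    case False
    then have n2: "real n \<ge> 2" by simp
    have "\<beta> * (real n + 2) \<le> 1 * (real n + 2)" using assms by (intro mult_right_mono) auto
    also have "\<dots> \<le> 2 * real n" using n2 by simp
    finally have "0 \<le> 2 * real n - \<beta> * (real n + 2)" by simp
    then have "0 \<le> (real n - 2) * (2 * real n - \<beta> * (real n + 2))"
      using False by (intro mult_nonneg_nonneg) simp_all
    then have "real n - \<beta> \<le> (2 - \<beta>) / 4 * (real n)\<^sup>2"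
      by (simp add: power2_eq_square field_simps)
    from mult_right_mono[OF this, of "cmod (c n)"] show ?thesis by (simp add: mult_ac)
  qed (simp add: c_eq_0)
  show sum: "summable (\<lambda>n. (real n - \<beta>) * cmod (c n))"
  proof (rule summable_weighted)
    fix n :: nat assume "n \<ge> 2"
    then have "real n * 1 \<le> (real n)\<^sup>2"
      unfolding power2_eq_square by (intro mult_left_mono) auto
    moreover have "real n \<ge> 2" using \<open>n \<ge> 2\<close> by simp
    ultimately show "\<bar>real n - \<beta>\<bar> \<le> (real n)\<^sup>2" using assms by linarith
  qed
  have "(\<Sum>n. (real n - \<beta>) * cmod (c n)) \<le> (\<Sum>n. (2 - \<beta>) / 4 * ((real n)\<^sup>2 * cmod (c n)))"
    by (intro suminf_le le sum summable_mult summable_c)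
  also have "\<dots> = (2 - \<beta>) / 4 * (\<Sum>n. (real n)\<^sup>2 * cmod (c n))"
    by (rule suminf_mult[OF summable_c])
  also have "\<dots> \<le> (2 - \<beta>) / 4 * 1" using assms suminf_c by (intro mult_left_mono) auto
  finally show "(\<Sum>n. (real n - \<beta>) * cmod (c n)) \<le> (2 - \<beta>) / 4" by simp
qed

text \<open>Express \<open>e\<close> through \<open>c\<close>. Up to the factor \<open>|\<alpha>|\<close>, the term \<open>(2 + \<beta>) / 2\<close> is the
  contribution of the leading coefficient 1 of \<open>h\<close>, and \<open>(3 + \<beta>) / 6\<close> is the largest
  ratio between the resulting weight of \<open>|c\<^sub>n|\<close> and \<open>n\<^sup>2\<close>, again attained at
  \<open>n = 2\<close>.\<close>

lemma g_coeff_bound: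
  assumes \<beta>: "0 \<le> \<beta>"
  shows "summable (\<lambda>n. (real n + \<beta>) * cmod (e n))"
    and "(\<Sum>n. (real n + \<beta>) * cmod (e n)) \<le> cmod \<alpha> * ((2 + \<beta>) / 2 + (3 + \<beta>) / 6)"
proof -
  define D where "D n = (if n = 1 then cmod \<alpha> * ((2 + \<beta>) / 2) else 0)
      + cmod \<alpha> * ((3 + \<beta>) / 6) * ((real n)\<^sup>2 * cmod (c n))" for n :: nat
  have le: "(real (Suc n) + \<beta>) * cmod (e (Suc n)) \<le> D n" for n
  proof -
    have "real (Suc n) * cmod (e (Suc n)) = cmod (of_nat (Suc n) * e (Suc n))"
      by (simp only: norm_mult norm_of_nat)
    also have "\<dots> = cmod \<alpha> * cmod (of_nat n * c n + (if n = 1 then 1 else 0))"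
      by (simp only: coeff_g norm_mult)
    finally have e: "cmod (e (Suc n))
        = cmod \<alpha> * cmod (of_nat n * c n + (if n = 1 then 1 else 0)) / real (Suc n)"
      by (simp add: field_simps)
    show ?thesis
    proof (cases "n < 2")
      case True
      then show ?thesis
        unfolding e by (auto simp: less_2_cases_iff D_def c_0 c_1[unfolded One_nat_def] field_simps)
    next
      case False
      then have e': "cmod (e (Suc n)) = cmod \<alpha> * (real n * cmod (c n)) / real (Suc n)"
        using e by (simp add: norm_mult)
      have "2 * real n \<le> real n * real n" using False by (intro mult_right_mono) auto
      then have n1: "real n \<le> (real n)\<^sup>2 / 2" by (simp add: power2_eq_square)
      have "2 * 3 \<le> real n * real (Suc n)" using False by (intro mult_mono) auto
      then have "6 * real n \<le> real n * (real n * real (Suc n))"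
        using mult_left_mono[of 6 "real n * real (Suc n)" "real n"] by (simp add: mult_ac)
      then have "real n / real (Suc n) \<le> (real n)\<^sup>2 / 6"
        by (simp add: power2_eq_square field_simps)
      from mult_left_mono[OF this \<beta>]
      have "real n + \<beta> * (real n / real (Suc n)) \<le> (real n)\<^sup>2 / 2 + \<beta> * ((real n)\<^sup>2 / 6)"
        using n1 by linarith
      also have "\<dots> = (3 + \<beta>) / 6 * (real n)\<^sup>2" by (simp add: field_simps)
      finally have "real n + \<beta> * (real n / real (Suc n)) \<le> (3 + \<beta>) / 6 * (real n)\<^sup>2" .
      moreover have "(real (Suc n) + \<beta>) * cmod (e (Suc n))
          = cmod \<alpha> * cmod (c n) * (real n + \<beta> * (real n / real (Suc n)))"
        unfolding e' by (simp add: field_simps)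
      ultimately have "(real (Suc n) + \<beta>) * cmod (e (Suc n))
          \<le> cmod \<alpha> * cmod (c n) * ((3 + \<beta>) / 6 * (real n)\<^sup>2)"
        by (simp only: mult_left_mono norm_ge_zero mult_nonneg_nonneg)
      also have "\<dots> = D n" using False by (simp add: D_def)
      finally show ?thesis .
    qed
  qed
  have Dsum: "D sums (cmod \<alpha> * ((2 + \<beta>) / 2)
      + cmod \<alpha> * ((3 + \<beta>) / 6) * (\<Sum>n. (real n)\<^sup>2 * cmod (c n)))"
    unfolding D_def by (intro sums_add sums_mult summable_sums summable_c sums_single)
  have "summable (\<lambda>n. (real (Suc n) + \<beta>) * cmod (e (Suc n)))"
    using \<beta> by (intro summable_comparison_test'[OF sums_summable[OF Dsum]])
      (use le in \<open>auto simp: abs_mult\<close>)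
  then show sum: "summable (\<lambda>n. (real n + \<beta>) * cmod (e n))"
    by (subst (asm) summable_Suc_iff)
  have "(\<Sum>n. (real n + \<beta>) * cmod (e n)) = (\<Sum>n. (real (Suc n) + \<beta>) * cmod (e (Suc n)))"
    using suminf_split_head[OF sum] by (simp add: e_0)
  also have "\<dots> \<le> suminf D"
    using sum sums_summable[OF Dsum] by (intro suminf_le le) (subst summable_Suc_iff)
  also have "\<dots> = cmod \<alpha> * ((2 + \<beta>) / 2)
      + cmod \<alpha> * ((3 + \<beta>) / 6) * (\<Sum>n. (real n)\<^sup>2 * cmod (c n))"
    using Dsum by (simp add: sums_iff)
  also have "\<dots> \<le> cmod \<alpha> * ((2 + \<beta>) / 2) + cmod \<alpha> * ((3 + \<beta>) / 6) * 1"
    using suminf_c \<beta> by (intro add_left_mono mult_left_mono) auto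
  finally show "(\<Sum>n. (real n + \<beta>) * cmod (e n))
      \<le> cmod \<alpha> * ((2 + \<beta>) / 2 + (3 + \<beta>) / 6)" by (simp add: algebra_simps)
qed

text \<open>The budget inequality combines the two previous bounds into
  \<open>\<Sum> ((n - \<beta>) |c\<^sub>n| + (n + \<beta>) |e\<^sub>n|) \<le> 1 - \<beta>\<close>, the coefficient condition for
  starlikeness of order \<open>\<beta>\<close> of a harmonic map. At \<open>|\<alpha>| = 1/3\<close> it forces
  \<open>\<beta> = 0\<close>.\<close>

context
  fixes \<beta> :: real
  assumes \<beta>: "0 \<le> \<beta>" "\<beta> < 1"
    and budget: "(2 - \<beta>) / 4 + cmod \<alpha> * ((2 + \<beta>) / 2 + (3 + \<beta>) / 6) \<le> 1 - \<beta>"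
begin

definition weight where "weight n = (real n - \<beta>) * cmod (c n) + (real n + \<beta>) * cmod (e n)"

lemma weight: "summable weight" "suminf weight \<le> 1 - \<beta>"
proof -
  note c = h_coeff_bound[of \<beta>] and e = g_coeff_bound[of \<beta>]
  have w: "weight = (\<lambda>n. (real n - \<beta>) * cmod (c n) + (real n + \<beta>) * cmod (e n))"
    by (simp add: fun_eq_iff weight_def)
  show "summable weight" unfolding w using \<beta> by (intro summable_add c e) auto
  have "suminf weight = (\<Sum>n. (real n - \<beta>) * cmod (c n)) + (\<Sum>n. (real n + \<beta>) * cmod (e n))"
    unfolding w using \<beta> by (intro suminf_add[symmetric] c e) auto
  then show "suminf weight \<le> 1 - \<beta>"
    using c(2) e(2) budget \<beta> by linarith
qed

lemma norm_term_le:
  assumes "cmod z < 1" "n \<ge> 2 \<Longrightarrow> 0 \<le> u" "n \<ge> 2 \<Longrightarrow> 0 \<le> v"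
  shows "cmod (of_real u * c n * z ^ n + s * cnj (of_real v * e n * z ^ n))
    \<le> (cmod z)\<^sup>2 * (u * cmod (c n) + cmod s * v * cmod (e n))"
proof (cases "n < 2")
  case False
  have p: "cmod z ^ n \<le> (cmod z)\<^sup>2" using assms(1) False by (intro power_decreasing) auto
  have "cmod (of_real u * c n * z ^ n + s * cnj (of_real v * e n * z ^ n))
      \<le> u * cmod (c n) * cmod z ^ n + cmod s * (v * cmod (e n) * cmod z ^ n)"
    using norm_triangle_ineq[of "of_real u * c n * z ^ n" "s * cnj (of_real v * e n * z ^ n)"]
      False assms by (simp add: norm_mult norm_power)
  also have "\<dots> \<le> u * cmod (c n) * (cmod z)\<^sup>2 + cmod s * (v * cmod (e n) * (cmod z)\<^sup>2)"
    using False assms p by (intro add_mono mult_left_mono) auto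
  finally show ?thesis by (simp add: algebra_simps)
qed (simp add: c_eq_0 e_eq_0)

lemma norm_f_minus_id:
  assumes z: "cmod z < 1" "z \<noteq> 0"
  shows "cmod (f z - z) < cmod z"
proof -
  have "(\<lambda>n. of_real (1 - \<beta>) * (c n * z ^ n + cnj (e n * z ^ n))) sums (of_real (1 - \<beta>) * ((h z - z) + cnj (g z)))"
    by (intro sums_mult sums_add series z iffD2[OF sums_cnj] series_g)
  then have "cmod (of_real (1 - \<beta>) * ((h z - z) + cnj (g z))) \<le> (\<Sum>n. (cmod z)\<^sup>2 * weight n)"
  proof (rule sums_norm_le)
    fix n
    have "cmod (of_real (1 - \<beta>) * (c n * z ^ n + cnj (e n * z ^ n)))
        \<le> (cmod z)\<^sup>2 * ((1 - \<beta>) * cmod (c n) + cmod 1 * (1 - \<beta>) * cmod (e n))"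
      using norm_term_le[of z n "1 - \<beta>" "1 - \<beta>" 1] z \<beta> by (simp add: algebra_simps)
    also have "\<dots> \<le> (cmod z)\<^sup>2 * weight n"
    proof (cases "n < 2")
      case False
      then show ?thesis unfolding weight_def using \<beta>
        by (intro mult_left_mono add_mono mult_right_mono) auto
    qed (simp add: c_eq_0 e_eq_0 weight_def)
    finally show "cmod (of_real (1 - \<beta>) * (c n * z ^ n + cnj (e n * z ^ n))) \<le> (cmod z)\<^sup>2 * weight n" .
  qed (intro summable_mult weight)
  also have "\<dots> = (cmod z)\<^sup>2 * suminf weight" by (rule suminf_mult[OF weight(1)])
  also have "\<dots> \<le> (cmod z)\<^sup>2 * (1 - \<beta>)" using weight by (intro mult_left_mono) auto
  finally have "(1 - \<beta>) * cmod (f z - z) \<le> (1 - \<beta>) * (cmod z)\<^sup>2"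
    unfolding norm_mult norm_of_real using \<beta> by (simp add: diff_add_eq mult.commute)
  then have "cmod (f z - z) \<le> (cmod z)\<^sup>2" using \<beta> by simp
  also have "\<dots> < cmod z" using z by (simp add: power2_eq_square)
  finally show ?thesis .
qed

text \<open>The quotient \<open>A / B\<close> of \<open>A = z h' - cnj (z g')\<close> by \<open>B = f z\<close> has real part equal
  to the derivative of the argument along circles, and it exceeds \<open>\<beta>\<close> exactly if \<open>A / B\<close> is
  closer to \<open>1 + \<beta>\<close> than to \<open>-(1 - \<beta>)\<close>, that is, if
  \<open>|A - (1 + \<beta>) B| < |A + (1 - \<beta>) B|\<close>. In this form the inequality can be checked on the
  coefficients: the two sides are close to \<open>\<beta> |z|\<close> and \<open>(2 - \<beta>) |z|\<close>, and the errors
  add up to at most \<open>2 |z|\<^sup>2 (1 - \<beta>)\<close>. The factor \<open>|z|\<^sup>2\<close> instead of \<open>|z|\<close>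
  gives strictness even if the coefficient condition is an equality.\<close>

proposition angular_derivative_gt:
  assumes z: "cmod z < 1" "z \<noteq> 0"
  shows "inner (z * deriv h z - cnj (z * deriv g z)) (f z) > \<beta> * (cmod (f z))\<^sup>2"
proof -
  define A where "A = z * deriv h z - cnj (z * deriv g z)"
  define B where "B = f z"
  define r where "r = cmod z"
  define X where "X = A + of_real (1 - \<beta>) * B"
  define Y where "Y = A - of_real (1 + \<beta>) * B"
  \<comment> \<open>The errors of \<open>X\<close> and \<open>Y\<close> are bounded by \<open>|z|\<^sup>2 (M + Q)\<close> and
    \<open>|z|\<^sup>2 (M - Q)\<close>; only the sum of the two matters, and \<open>Q\<close> cancels.\<close>
  define M Q where "M = suminf weight" and "Q = (\<Sum>n. cmod (c n) - cmod (e n))"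
  have r: "0 < r" "r < 1" using z by (auto simp: r_def)
  have sumQ: "summable (\<lambda>n. cmod (c n) - cmod (e n))"
  proof (rule summable_diff)
    have "summable (\<lambda>n. 1 * cmod (c n))"
    proof (rule summable_weighted)
      show "\<bar>1\<bar> \<le> (real n)\<^sup>2" if "n \<ge> 2" for n :: nat using that by (simp add: one_le_power)
    qed
    then show "summable (\<lambda>n. cmod (c n))" by simp
    have "summable (\<lambda>n. (real n + 0) * cmod (e n))" by (rule g_coeff_bound) simp
    moreover have "norm (cmod (e n)) \<le> (real n + 0) * cmod (e n)" for n
      using e_0 mult_right_mono[of 1 "real n" "cmod (e n)"] by (cases n) auto
    ultimately show "summable (\<lambda>n. cmod (e n))" by (blast intro: summable_comparison_test')
  qed
  note hs = series_deriv[OF z(1)] series[OF z(1)]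
    iffD2[OF sums_cnj series_deriv_g[OF z(1)]] iffD2[OF sums_cnj series_g[OF z(1)]]
  have "(\<lambda>n. of_real (real n + 1 - \<beta>) * c n * z ^ n + (-1) * cnj (of_real (real n - 1 + \<beta>) * e n * z ^ n))
      sums (X - of_real (2 - \<beta>) * z)"
    using sums_diff[OF sums_add[OF hs(1) sums_mult[OF hs(2), of "of_real (1 - \<beta>)"]]
        sums_diff[OF hs(3) sums_mult[OF hs(4), of "of_real (1 - \<beta>)"]]]
    by (simp add: X_def A_def B_def algebra_simps)
  then have "cmod (X - of_real (2 - \<beta>) * z)
      \<le> (\<Sum>n. r\<^sup>2 * (weight n + (cmod (c n) - cmod (e n))))"
  proof (rule sums_norm_le)
    show "cmod (of_real (real n + 1 - \<beta>) * c n * z ^ n + (-1) * cnj (of_real (real n - 1 + \<beta>) * e n * z ^ n))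
        \<le> r\<^sup>2 * (weight n + (cmod (c n) - cmod (e n)))" for n
      by (rule order_trans[OF norm_term_le]) (use z \<beta> in \<open>auto simp: r_def weight_def algebra_simps\<close>)
  qed (intro summable_mult summable_add weight sumQ)
  also have "\<dots> = r\<^sup>2 * (M + Q)"
    unfolding M_def Q_def suminf_add[OF weight(1) sumQ]
    by (intro suminf_mult summable_add weight sumQ)
  finally have "cmod (X - of_real (2 - \<beta>) * z) \<le> r\<^sup>2 * (M + Q)" .
  moreover have "cmod (of_real (2 - \<beta>) * z) \<le> cmod X + cmod (X - of_real (2 - \<beta>) * z)"
    using norm_triangle_ineq4[of X "X - of_real (2 - \<beta>) * z"] by simp
  moreover have "cmod (of_real (2 - \<beta>) * z) = (2 - \<beta>) * r"
    unfolding norm_mult norm_of_real r_def using \<beta> by simp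
  ultimately have X: "cmod X \<ge> (2 - \<beta>) * r - r\<^sup>2 * (M + Q)" by linarith
  have "(\<lambda>n. of_real (real n - 1 - \<beta>) * c n * z ^ n + (-1) * cnj (of_real (real n + 1 + \<beta>) * e n * z ^ n))
      sums (Y - of_real (- \<beta>) * z)"
    using sums_diff[OF sums_diff[OF hs(1) sums_mult[OF hs(2), of "of_real (1 + \<beta>)"]]
        sums_add[OF hs(3) sums_mult[OF hs(4), of "of_real (1 + \<beta>)"]]]
    by (simp add: Y_def A_def B_def algebra_simps)
  then have "cmod (Y - of_real (- \<beta>) * z)
      \<le> (\<Sum>n. r\<^sup>2 * (weight n - (cmod (c n) - cmod (e n))))"
  proof (rule sums_norm_le)
    show "cmod (of_real (real n - 1 - \<beta>) * c n * z ^ n + (-1) * cnj (of_real (real n + 1 + \<beta>) * e n * z ^ n))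
        \<le> r\<^sup>2 * (weight n - (cmod (c n) - cmod (e n)))" for n
      by (rule order_trans[OF norm_term_le]) (use z \<beta> in \<open>auto simp: r_def weight_def algebra_simps\<close>)
  qed (intro summable_mult summable_diff weight sumQ)
  also have "\<dots> = r\<^sup>2 * (M - Q)"
    unfolding M_def Q_def suminf_diff[OF weight(1) sumQ]
    by (intro suminf_mult summable_diff weight sumQ)
  finally have "cmod (Y - of_real (- \<beta>) * z) \<le> r\<^sup>2 * (M - Q)" .
  moreover have "cmod Y \<le> cmod (Y - of_real (- \<beta>) * z) + cmod (of_real (- \<beta>) * z)"
    using norm_triangle_ineq[of "Y - of_real (- \<beta>) * z" "of_real (- \<beta>) * z"] by simp
  moreover have "cmod (of_real (- \<beta>) * z) = \<beta> * r"
    unfolding norm_mult norm_of_real r_def using \<beta> by simp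
  ultimately have Y: "cmod Y \<le> \<beta> * r + r\<^sup>2 * (M - Q)" by linarith
  have "r\<^sup>2 * M \<le> r\<^sup>2 * (1 - \<beta>)" using weight by (intro mult_left_mono) (auto simp: M_def)
  also have "\<dots> < r * (1 - \<beta>)"
    using r \<beta> by (intro mult_strict_right_mono) (auto simp: power2_eq_square)
  finally have "cmod Y < cmod X" using X Y by (simp add: algebra_simps)
  then have "(cmod Y)\<^sup>2 < (cmod X)\<^sup>2" by (intro power_strict_mono) auto
  moreover have "(cmod X)\<^sup>2 - (cmod Y)\<^sup>2 = 4 * (inner A B - \<beta> * (cmod B)\<^sup>2)"
    unfolding X_def Y_def cmod_power2 inner_complex_def
    by (simp add: power2_eq_square algebra_simps)
  ultimately show ?thesis unfolding A_def B_def by simp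
qed

end

end


section \<open>Fully starlike and close-to-convex harmonic maps\<close>

lemma wirtinger_plus_cnj:
  assumes f: "\<And>w. w \<in> ball 0 1 \<Longrightarrow> f w = h w + cnj (g w)" and z: "z \<in> ball 0 1"
    and "(h has_field_derivative a) (at z)" "(g has_field_derivative b) (at z)"
  shows "wirtinger f z = a" and "wirtinger_bar f z = cnj b"
proof -
  have "(f has_derivative (\<lambda>v. a * v + cnj (b * v))) (at z)"
    using has_derivative_plus_cnj[OF assms(3,4)]
    by (rule has_derivative_transform_within_open[where s = "ball 0 1"]) (use f z in auto)
  then have "frechet_derivative f (at z) = (\<lambda>v. a * v + cnj (b * v))"
    using frechet_derivative_at by metis
  then show "wirtinger f z = a" "wirtinger_bar f z = cnj b"
    by (auto simp: wirtinger_def wirtinger_bar_def dx_def dy_def algebra_simps)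
qed

theorem theorem2p3:
  fixes f h g :: "complex \<Rightarrow> complex" and a b :: "nat \<Rightarrow> complex" and \<alpha> :: complex
  assumes "f \<in> class_H"
    and "h holomorphic_on unit_disc" and "g holomorphic_on unit_disc"
    and "\<And>z. z \<in> unit_disc \<Longrightarrow> f z = h z + cnj (g z)"
    and "\<And>z. z \<in> unit_disc \<Longrightarrow> (\<lambda>n. a (n + 2) * z ^ (n + 2)) sums (h z - z)"
    and "\<And>z. z \<in> unit_disc \<Longrightarrow> (\<lambda>n. b (n + 1) * z ^ (n + 1)) sums g z"
    and "\<And>z. z \<in> unit_disc \<Longrightarrow> deriv g z = \<alpha> * z * deriv h z"
    and "summable (\<lambda>n. (real (n + 2))\<^sup>2 * cmod (a (n + 2)))"
    and "(\<Sum>n. (real (n + 2))\<^sup>2 * cmod (a (n + 2))) \<le> 1"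
  shows "(cmod \<alpha> \<le> 1 \<longrightarrow> univalent_on f unit_disc \<and> close_to_convex f) \<and>
         (cmod \<alpha> \<le> 1 / 3 \<longrightarrow>
            fully_starlike (2 * (1 - 3 * cmod \<alpha>) / (5 + 3 * cmod \<alpha>)) f)"
proof -
  define c where "c n = (if n < 2 then 0 else a n)" for n
  define e where "e n = (if n = 0 then 0 else b n)" for n
  define F where "F z = h z + cnj (g z)" for z
  have fF: "f z = F z" if "z \<in> ball 0 1" for z using assms(4)[OF that] by (simp add: F_def)
  have img: "f ` ball 0 1 = F ` ball 0 1" using fF by (intro image_cong) auto
  have inj_iff: "inj_on f (ball 0 1) \<longleftrightarrow> inj_on F (ball 0 1)" using fF by (intro inj_on_cong)
  have c2: "c (n + 2) = a (n + 2)" for n by (simp add: c_def)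
  have cs: "(\<lambda>n. (real n)\<^sup>2 * cmod (c n)) sums (\<Sum>n. (real (n + 2))\<^sup>2 * cmod (a (n + 2)))"
    using summable_sums[OF assms(8)] unfolding c2[symmetric]
    by (subst (asm) sums_zero_iff_shift) (auto simp: c_def)
  interpret convex_shear h c g e \<alpha>
  proof
    show "(\<lambda>n. c n * z ^ n) sums (h z - z)" if "cmod z < 1" for z
      using assms(5)[of z, simplified dist_0_norm mem_ball, OF that] unfolding c2[symmetric]
      by (subst (asm) sums_zero_iff_shift) (auto simp: c_def)
    show "(\<lambda>n. e n * z ^ n) sums g z" if "cmod z < 1" for z
      using assms(6)[of z] that
      by (intro sums_Suc_imp[of "\<lambda>n. e n * z ^ n"]) (auto simp: e_def)
    show "summable (\<lambda>n. (real n)\<^sup>2 * cmod (c n))" using cs by (rule sums_summable)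
    show "(\<Sum>n. (real n)\<^sup>2 * cmod (c n)) \<le> 1" using cs assms(9) by (simp add: sums_iff)
  qed (use assms in \<open>auto simp: c_def e_def\<close>)
  have part1: "univalent_on f unit_disc \<and> close_to_convex f" if "cmod \<alpha> \<le> 1"
    using univalent[OF that] close_to_convex_image[OF that] assms(1)
    unfolding close_to_convex_def univalent_on_def inj_iff img
    by (simp add: F_def[abs_def] class_H_def)
  have part2: "fully_starlike (2 * (1 - 3 * cmod \<alpha>) / (5 + 3 * cmod \<alpha>)) f" if \<alpha>: "cmod \<alpha> \<le> 1 / 3"
  proof -
    define \<beta> where "\<beta> = 2 * (1 - 3 * cmod \<alpha>) / (5 + 3 * cmod \<alpha>)"
    have pos: "5 + 3 * cmod \<alpha> > 0" by (simp add: add_pos_nonneg)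
    have "2 * (1 - 3 * cmod \<alpha>) < 5 + 3 * cmod \<alpha>"
      using norm_ge_zero[of \<alpha>] by (simp add: algebra_simps del: norm_ge_zero)
    then have \<beta>: "0 \<le> \<beta>" "\<beta> < 1"
      using \<alpha> pos by (simp_all add: \<beta>_def)
    \<comment> \<open>Cleared of denominators, the budget is \<open>\<beta> (9 + 8 |\<alpha>|) \<le> 6 (1 - 3 |\<alpha>|)\<close>, while the
      definition of \<open>\<beta>\<close> reads \<open>\<beta> (15 + 9 |\<alpha>|) = 6 (1 - 3 |\<alpha>|)\<close>.\<close>
    have budget: "(2 - \<beta>) / 4 + cmod \<alpha> * ((2 + \<beta>) / 2 + (3 + \<beta>) / 6) \<le> 1 - \<beta>"
    proof -
      have "\<beta> * (5 + 3 * cmod \<alpha>) = 2 * (1 - 3 * cmod \<alpha>)" using pos by (simp add: \<beta>_def)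
      moreover have "0 \<le> \<beta> * (6 + cmod \<alpha>)" using \<beta> by simp
      ultimately show ?thesis by (simp add: field_simps)
    qed
    note near = norm_f_minus_id[OF \<beta> budget]
      and ang = angular_derivative_gt[OF \<beta> budget]
    have \<alpha>1: "cmod \<alpha> \<le> 1" using \<alpha> by simp
    have F0: "F 0 = 0" by (simp add: F_def h_0 g_0)
    have "starlike_domain (F ` ball 0 1)"
      unfolding F_def[abs_def]
    proof (rule starlike_image_of_increasing_arg[OF holo holo_g univalent[OF \<alpha>1]])
      fix z :: complex assume "z \<in> ball 0 1" "z \<noteq> 0"
      then show "0 < inner (z * deriv h z - cnj (z * deriv g z)) (h z + cnj (g z))"
        using ang[of z] \<beta> by (force intro: le_less_trans[rotated])
    qed (use dilatation_less[OF \<alpha>1] F0 in \<open>auto simp: F_def\<close>)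
    moreover have "sense_preserving_on f unit_disc"
      unfolding sense_preserving_on_def
    proof
      fix z :: complex assume z: "z \<in> ball 0 1"
      then show "(cmod (wirtinger f z))\<^sup>2 - (cmod (wirtinger_bar f z))\<^sup>2 > 0"
        using dilatation_less[OF \<alpha>1, of z] z
          wirtinger_plus_cnj[OF assms(4) z DERIV_h[of z] DERIV_g[of z]]
        by (simp add: power_strict_mono)
    qed
    moreover have "\<exists>\<phi>. arg_branch (\<lambda>\<theta>. f (of_real r * cis \<theta>)) \<phi> \<and>
        (\<forall>\<theta>. 0 \<le> \<theta> \<and> \<theta> < 2 * pi \<longrightarrow> (\<exists>D. (\<phi> has_real_derivative D) (at \<theta>) \<and> D > \<beta>))"
      if r: "0 < r" "r < 1" for r
    proof -
      have near_r: "cmod (F z - z) < cmod z" if "cmod z = r" for z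
        using near[of z] r that by (auto simp: F_def)
      have dF: "(F has_derivative (\<lambda>v. deriv h z * v + cnj (deriv g z * v))) (at z)"
        if "cmod z = r" for z
        unfolding F_def[abs_def] using r that by (intro has_derivative_plus_cnj DERIV_h DERIV_g) auto
      obtain \<phi> where \<phi>: "arg_branch (\<lambda>\<theta>. F (of_real r * cis \<theta>)) \<phi>"
        "\<And>\<theta> z. z = of_real r * cis \<theta> \<Longrightarrow> (\<phi> has_real_derivative
          Im ((deriv h z * (\<i> * z) + cnj (deriv g z * (\<i> * z))) / F z)) (at \<theta>)"
        using arg_branch_near_identity[OF r(1) near_r dF] by blast
      have "\<exists>D. (\<phi> has_real_derivative D) (at \<theta>) \<and> D > \<beta>" for \<theta>
      proof -
        define z where "z = of_real r * cis \<theta>"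
        have z: "cmod z < 1" "z \<noteq> 0" using r by (auto simp: z_def norm_mult)
        define A where "A = z * deriv h z - cnj (z * deriv g z)"
        have Fz: "F z \<noteq> 0" using near[OF z] z by (auto simp: F_def)
        have "(deriv h z * (\<i> * z) + cnj (deriv g z * (\<i> * z))) / F z = \<i> * (A / F z)"
          by (simp add: A_def algebra_simps diff_divide_distrib add_divide_distrib)
        also have "Im \<dots> = Re (A / F z)" by (rule Im_i_times)
        also have "\<dots> = inner A (F z) / (cmod (F z))\<^sup>2"
          by (simp add: Re_divide inner_complex_def cmod_power2 add_divide_distrib)
        also have "\<dots> > \<beta>" using ang[OF z] Fz by (simp add: A_def F_def pos_less_divide_eq)
        finally have "\<beta> < Im ((deriv h z * (\<i> * z) + cnj (deriv g z * (\<i> * z))) / F z)" .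
        then show ?thesis using \<phi>(2)[OF z_def] by blast
      qed
      moreover have "arg_branch (\<lambda>\<theta>. f (of_real r * cis \<theta>)) \<phi>"
        using \<phi>(1) r by (simp add: fF norm_mult)
      ultimately show ?thesis by blast
    qed
    ultimately show ?thesis
      using part1[OF \<alpha>1] \<beta> assms(1) unfolding fully_starlike_def \<beta>_def[symmetric] img by blast
  qed
  show ?thesis using part1 part2 by blast
qed

end
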